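(* Let $T_0,\dots,T_{n-1}$ be a Random Forest of $n$ decision trees, each of height at most $h$, and let $X=(x_1,\dots,x_d)$ be an input object to which the algorithm has only quantum oracle access. Let $\hat y_i$ denote the output of tree $T_i$ on $X$, let $R=\frac1n\sum_{i=0}^{n-1}\hat y_i$ be the Random Forest prediction, and let $$\beta=\frac1n\sum_{i=0}^{n-1}\frac{\hat y_i-y_{\min}}{y_{\max}-y_{\min}}\in[0,1],$$ where $y_{\min}<y_{\max}$ are the minimum and maximum leaf labels over all trees. Then for every positive integer $t$ and every $\delta\in(0,1)$: (i) there is a quantum query algorithm that outputs $\tilde\beta$ with $|\tilde\beta-\beta|\le \frac{2\pi}{t}+\frac{\pi^2}{t^2}$ with probability at least $1-\delta$, using $O(t\cdot h\cdot\log\frac1\delta)$ queries to $X$; (ii) there is a quantum query algorithm that outputs $\tilde R$ with $|\tilde R-R|\le (y_{\max}-y_{\min})\left(\frac{2\pi}{T}+\frac{\pi^2}{T^2}\right)$, where $T=\lceil t(y_{\max}-y_{\min})\rceil$, with probability at least $1-\delta$, using $O(t\,(y_{\max}-y_{\min})\cdot h\cdot\log\frac1\delta)$ queries to $X$.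
   Context: An object is $X=(x_1,\dots,x_d)$, each attribute $x_j$ real-valued or taking values in $\{1,\dots,W_j\}$. A decision tree is a rooted tree (here binary, of height at most $h$) in which each inner node is labeled by a condition on a single attribute of the input (e.g. $x_j>\theta$ or $x_j=\theta$ for a constant $\theta$) with two outgoing edges labeled by the outcomes, and each leaf is labeled by a real number. The output of a tree on $X$ is the label of the leaf reached by starting at the root and repeatedly following the edge labeled by the outcome of the current node's condition on $X$. A Random Forest is a finite set of decision trees $\{T_0,\dots,T_{n-1}\}$ and its prediction on $X$ is the average $\frac1n\sum_i \hat y_i$ of the tree outputs. Query model: the input $X$ is accessible only through an oracle unitary $|j\rangle|z\rangle|w\rangle\mapsto|j\rangle|z\oplus x_j\rangle|w\rangle$ (with attribute values encoded in binary); the algorithm alternates input-independent unitaries with oracle calls and ends with a measurement; query complexity is the number of oracle calls. Evaluating the condition at one tree node costs one query. The forest (tree structures, conditions, leaf labels, $y_{\min}$, $y_{\max}$) is fixed and known to the algorithm; $n$ may be assumed a power of two. *)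

theory Defs
  imports "HOL-Analysis.Analysis"
begin

text \<open>Attribute values are accessed in their binary encoding: an attribute value is a
  natural number below 2^b. A node tests a condition on one attribute j (an arbitrary
  predicate on the encoded value of x_j, e.g. x_j > theta or x_j = theta).
  Attributes are indexed 0..d-1.\<close>

datatype dtree = Leaf real | Node nat "nat \<Rightarrow> bool" dtree dtree

fun eval_tree :: "dtree \<Rightarrow> (nat \<Rightarrow> nat) \<Rightarrow> real" where
  "eval_tree (Leaf y) X = y"
| "eval_tree (Node j c l r) X = (if c (X j) then eval_tree l X else eval_tree r X)"

fun height :: "dtree \<Rightarrow> nat" where
  "height (Leaf y) = 0"
| "height (Node j c l r) = Suc (max (height l) (height r))"

fun leaf_labels :: "dtree \<Rightarrow> real set" where
  "leaf_labels (Leaf y) = {y}"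
| "leaf_labels (Node j c l r) = leaf_labels l \<union> leaf_labels r"

fun attrs_ok :: "nat \<Rightarrow> dtree \<Rightarrow> bool" where
  "attrs_ok d (Leaf y) = True"
| "attrs_ok d (Node j c l r) = (j < d \<and> attrs_ok d l \<and> attrs_ok d r)"

definition y_min :: "dtree list \<Rightarrow> real" where
  "y_min F = Min (\<Union>T\<in>set F. leaf_labels T)"

definition y_max :: "dtree list \<Rightarrow> real" where
  "y_max F = Max (\<Union>T\<in>set F. leaf_labels T)"

definition forest_pred :: "dtree list \<Rightarrow> (nat \<Rightarrow> nat) \<Rightarrow> real" where
  "forest_pred F X = (1 / real (length F)) * (\<Sum>i<length F. eval_tree (F ! i) X)"

definition forest_beta :: "dtree list \<Rightarrow> (nat \<Rightarrow> nat) \<Rightarrow> real" where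
  "forest_beta F X = (1 / real (length F)) *
     (\<Sum>i<length F. (eval_tree (F ! i) X - y_min F) / (y_max F - y_min F))"

definition forest_ok :: "dtree list \<Rightarrow> nat \<Rightarrow> nat \<Rightarrow> bool" where
  "forest_ok F h d \<longleftrightarrow> F \<noteq> [] \<and> (\<exists>k. length F = 2 ^ k) \<and>
     (\<forall>T\<in>set F. height T \<le> h \<and> attrs_ok d T) \<and> y_min F < y_max F"

definition valid_input :: "nat \<Rightarrow> nat \<Rightarrow> (nat \<Rightarrow> nat) \<Rightarrow> bool" where
  "valid_input d b X \<longleftrightarrow> (\<forall>j<d. X j < 2 ^ b)"

text \<open>The state space is spanned by basis states |j,z,w> with index register j < d,
  answer register z < 2^b and workspace register w < M. States are complex functions
  on the basis, operators are complex matrices indexed by basis states.\<close>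

type_synonym basis = "nat \<times> nat \<times> nat"
type_synonym qstate = "basis \<Rightarrow> complex"
type_synonym qop = "basis \<Rightarrow> basis \<Rightarrow> complex"

definition qbasis :: "nat \<Rightarrow> nat \<Rightarrow> nat \<Rightarrow> basis set" where
  "qbasis d b M = {..<d} \<times> {..<2 ^ b} \<times> {..<M}"

definition unitary_on :: "basis set \<Rightarrow> qop \<Rightarrow> bool" where
  "unitary_on B U \<longleftrightarrow>
     (\<forall>i\<in>B. \<forall>j\<in>B. (\<Sum>k\<in>B. cnj (U k i) * U k j) = (if i = j then 1 else 0))"

definition apply_op :: "basis set \<Rightarrow> qop \<Rightarrow> qstate \<Rightarrow> qstate" where
  "apply_op B U \<psi> = (\<lambda>i. if i \<in> B then (\<Sum>j\<in>B. U i j * \<psi> j) else 0)"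

text \<open>The oracle |j>|z>|w> \<mapsto> |j>|z xor x_j>|w> (xor is an involution).\<close>

definition oracle_op :: "basis set \<Rightarrow> (nat \<Rightarrow> nat) \<Rightarrow> qstate \<Rightarrow> qstate" where
  "oracle_op B X \<psi> = (\<lambda>(j, z, w). if (j, z, w) \<in> B then \<psi> (j, xor z (X j), w) else 0)"

definition init_state :: qstate where
  "init_state = (\<lambda>i. if i = (0, 0, 0) then 1 else 0)"

text \<open>An algorithm is given by the workspace size M, input-independent unitaries
  U0, U1, ..., Uk (the list Us = [U1,...,Uk]) and a classical post-processing map
  out of the measurement outcome. It computes Uk O_X ... U1 O_X U0 |0,0,0>,
  measures in the computational basis and outputs out of the outcome.
  Its query complexity is k = length Us.\<close>

definition is_query_alg :: "nat \<Rightarrow> nat \<Rightarrow> nat \<Rightarrow> qop \<Rightarrow> qop list \<Rightarrow> bool" where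
  "is_query_alg d b M U0 Us \<longleftrightarrow> 0 < M \<and> unitary_on (qbasis d b M) U0 \<and>
     (\<forall>U\<in>set Us. unitary_on (qbasis d b M) U)"

definition final_state :: "nat \<Rightarrow> nat \<Rightarrow> nat \<Rightarrow> qop \<Rightarrow> qop list \<Rightarrow> (nat \<Rightarrow> nat) \<Rightarrow> qstate" where
  "final_state d b M U0 Us X =
     fold (\<lambda>U \<psi>. apply_op (qbasis d b M) U (oracle_op (qbasis d b M) X \<psi>)) Us
          (apply_op (qbasis d b M) U0 init_state)"

definition out_prob :: "nat \<Rightarrow> nat \<Rightarrow> nat \<Rightarrow> qop \<Rightarrow> qop list \<Rightarrow> (basis \<Rightarrow> real)
    \<Rightarrow> (nat \<Rightarrow> nat) \<Rightarrow> real set \<Rightarrow> real" where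
  "out_prob d b M U0 Us out X S =
     (\<Sum>i\<in>{i\<in>qbasis d b M. out i \<in> S}. (cmod (final_state d b M U0 Us X i))\<^sup>2)"

end

theory Submission
  imports Defs
begin

text \<open>Amplitude estimation in the form of a walk. Coherent evaluation \<open>E\<close> of all trees, with
  the branch outcomes written to the workspace (two queries per level, the second one
  erasing the answer register), yields a reflection \<open>S\<close> and a state \<open>v\<close> with
  \<open>\<langle>v, S v\<rangle> = 1 - 2 \<beta>\<close>. The walk \<open>W = (1 - 2 v v\<^sup>*) S\<close> then satisfies
  \<open>\<langle>v, W\<^bsup>k\<^esup> v\<rangle> = cos (k \<theta>)\<close> with \<open>cos \<theta> = 2 \<beta> - 1\<close>, and phase estimation recovers \<open>\<theta>\<close> up to sign.
  Instead of taking a median of repetitions, the control register is prepared in a window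
  whose Fourier transform is a power \<open>K = O(log (1/\<delta>))\<close> of the Dirichlet kernel of length \<open>t\<close>,
  so that one run with \<open>K (t - 1)\<close> walk steps already fails with probability at most \<open>\<delta>\<close>.
  For the forest prediction, precision \<open>T \<le> 6\<close> is trivial (no queries), and otherwise
  \<open>T \<le> 2 t (y\<^sub>m\<^sub>a\<^sub>x - y\<^sub>m\<^sub>i\<^sub>n)\<close>.\<close>

section \<open>Matrices on finite bases\<close>

text \<open>Three features of the model shape the circuit. The oracle comes without a control, so a
  walk step that is switched off still issues its queries; this is harmless because each step
  contains an even number of them and the oracle is an involution. The only measurement is at the
  end, so a single reliable run is simpler than a median, which would need several copies side by
  side. The unitaries may not depend on \<open>X\<close>, whereas the angle \<theta> does, so
  spectral facts enter only in the analysis for a fixed \<open>X\<close>. No eigenvectors are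
  needed: the outcome distribution depends only on the Gram matrix cos((k-l)\<theta>) of the walk
  vectors, an even mixture of the phases \<theta> and -\<theta>. The error 2 pi/t comes from |cos
  \<psi> - cos \<theta>| = 2 |sin((\<theta>-\<psi>)/2)| |sin((\<theta>+\<psi>)/2)|: an estimate of
  \<beta> that is off by more than 2 pi/t makes both sines at least 2 pi/t, and there the Dirichlet
  kernel is at most t/(2 pi) < t/6. Small T is separated because T can exceed t times the label
  range by an arbitrary factor when that product is below 1, so running with T in place of t would
  break the query bound.\<close>

definition app :: "'a set \<Rightarrow> ('a \<Rightarrow> 'a \<Rightarrow> complex) \<Rightarrow> ('a \<Rightarrow> complex) \<Rightarrow> 'a \<Rightarrow> complex" where
  "app B U \<psi> = (\<lambda>i. if i \<in> B then (\<Sum>j\<in>B. U i j * \<psi> j) else 0)"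

definition uni :: "'a set \<Rightarrow> ('a \<Rightarrow> 'a \<Rightarrow> complex) \<Rightarrow> bool" where
  "uni B U \<longleftrightarrow> (\<forall>i\<in>B. \<forall>j\<in>B. (\<Sum>k\<in>B. cnj (U k i) * U k j) = (if i = j then 1 else 0))"

definition ip :: "'a set \<Rightarrow> ('a \<Rightarrow> complex) \<Rightarrow> ('a \<Rightarrow> complex) \<Rightarrow> complex" where
  "ip B \<phi> \<psi> = (\<Sum>i\<in>B. cnj (\<phi> i) * \<psi> i)"

definition supported :: "'a set \<Rightarrow> ('a \<Rightarrow> complex) \<Rightarrow> bool" where
  "supported B \<psi> \<longleftrightarrow> (\<forall>i. i \<notin> B \<longrightarrow> \<psi> i = 0)"

definition mat_mul :: "'a set \<Rightarrow> ('a \<Rightarrow> 'a \<Rightarrow> complex) \<Rightarrow> ('a \<Rightarrow> 'a \<Rightarrow> complex) \<Rightarrow> 'a \<Rightarrow> 'a \<Rightarrow> complex" where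
  "mat_mul B U V = (\<lambda>i j. \<Sum>k\<in>B. U i k * V k j)"

definition idm :: "'a \<Rightarrow> 'a \<Rightarrow> complex" where
  "idm = (\<lambda>i j. if i = j then 1 else 0)"

text \<open>The matrix acts by precomposition with \<pi>, hence moves basis vectors along the
  inverse of \<pi>. The permutations used below are involutions, for which the direction does not
  matter.\<close>

definition perm :: "('a \<Rightarrow> 'a) \<Rightarrow> 'a \<Rightarrow> 'a \<Rightarrow> complex" where
  "perm \<pi> = (\<lambda>i j. if j = \<pi> i then 1 else 0)"

definition refl_mat :: "('a \<Rightarrow> 'a \<Rightarrow> complex) \<Rightarrow> 'a \<Rightarrow> 'a \<Rightarrow> complex" where
  "refl_mat P = (\<lambda>i j. (if i = j then 1 else 0) - 2 * P i j)"

text \<open>The operator calculus is polymorphic in the basis because circuits are built over nested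
  product workspaces; this equation and the next lead back to the model.\<close>

lemma unitary_on_uni: "unitary_on = uni"
  by (intro ext) (simp add: unitary_on_def uni_def)

lemma apply_op_app: "apply_op = app"
  by (intro ext) (simp add: apply_op_def app_def)

lemma supported_app [simp]: "supported B (app B U \<psi>)"
  by (simp add: supported_def app_def)

lemma ip_app:
  assumes "finite B" "uni B U"
  shows "ip B (app B U \<phi>) (app B U \<psi>) = ip B \<phi> \<psi>"
proof -
  have "ip B (app B U \<phi>) (app B U \<psi>)
      = (\<Sum>k\<in>B. (\<Sum>i\<in>B. cnj (U k i) * cnj (\<phi> i)) * (\<Sum>j\<in>B. U k j * \<psi> j))"
    by (simp add: ip_def app_def)
  also have "\<dots> = (\<Sum>k\<in>B. \<Sum>i\<in>B. \<Sum>j\<in>B. cnj (\<phi> i) * \<psi> j * (cnj (U k i) * U k j))"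
    unfolding sum_product by (intro sum.cong HOL.refl) (simp add: mult_ac)
  also have "\<dots> = (\<Sum>i\<in>B. \<Sum>k\<in>B. \<Sum>j\<in>B. cnj (\<phi> i) * \<psi> j * (cnj (U k i) * U k j))"
    by (rule sum.swap)
  also have "\<dots> = (\<Sum>i\<in>B. \<Sum>j\<in>B. cnj (\<phi> i) * \<psi> j * (\<Sum>k\<in>B. cnj (U k i) * U k j))"
    by (rule sum.cong[OF HOL.refl], subst sum.swap) (simp add: sum_distrib_left)
  also have "\<dots> = (\<Sum>i\<in>B. \<Sum>j\<in>B. if i = j then cnj (\<phi> i) * \<psi> j else 0)"
    using assms(2) by (intro sum.cong refl) (auto simp: uni_def)
  also have "\<dots> = ip B \<phi> \<psi>"
    using assms(1) by (simp add: ip_def)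
  finally show ?thesis .
qed

lemma app_mat_mul: "app B (mat_mul B U V) \<psi> = app B U (app B V \<psi>)"
proof
  fix i
  have "(\<Sum>j\<in>B. (\<Sum>k\<in>B. U i k * V k j) * \<psi> j) = (\<Sum>k\<in>B. U i k * (\<Sum>j\<in>B. V k j * \<psi> j))"
    by (simp add: sum_distrib_left sum_distrib_right mult.assoc) (rule sum.swap)
  thus "app B (mat_mul B U V) \<psi> i = app B U (app B V \<psi>) i"
    by (simp add: app_def mat_mul_def)
qed

lemma uni_mat_mul:
  assumes "finite B" "uni B U" "uni B V"
  shows "uni B (mat_mul B U V)"
  unfolding uni_def
proof (intro ballI)
  fix i j assume ij: "i \<in> B" "j \<in> B"
  have "(\<Sum>k\<in>B. cnj (mat_mul B U V k i) * mat_mul B U V k j)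
      = ip B (app B U (\<lambda>m. V m i)) (app B U (\<lambda>m. V m j))"
    by (simp add: ip_def app_def mat_mul_def)
  also have "\<dots> = ip B (\<lambda>m. V m i) (\<lambda>m. V m j)"
    by (rule ip_app) fact+
  also have "\<dots> = (if i = j then 1 else 0)"
    using assms(3) ij by (simp add: ip_def uni_def)
  finally show "(\<Sum>k\<in>B. cnj (mat_mul B U V k i) * mat_mul B U V k j) = (if i = j then 1 else 0)" .
qed

lemma uni_perm:
  assumes "finite B" "bij_betw \<pi> B B"
  shows "uni B (perm \<pi>)"
  unfolding uni_def
proof (intro ballI)
  fix i j assume ij: "i \<in> B" "j \<in> B"
  have "(\<Sum>k\<in>B. cnj (perm \<pi> k i) * perm \<pi> k j)
      = (\<Sum>k\<in>B. (\<lambda>m. if i = m then (if j = m then 1 else 0) else 0) (\<pi> k))"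
    by (intro sum.cong refl) (auto simp: perm_def)
  also have "\<dots> = (\<Sum>m\<in>B. if i = m then (if j = m then 1 else 0) else 0)"
    by (rule sum.reindex_bij_betw) fact
  also have "\<dots> = (if i = j then 1 else 0)"
    using assms(1) ij by simp
  finally show "(\<Sum>k\<in>B. cnj (perm \<pi> k i) * perm \<pi> k j) = (if i = j then 1 else 0)" .
qed

lemma app_perm:
  assumes "finite B" "\<And>i. i \<in> B \<Longrightarrow> \<pi> i \<in> B"
  shows "app B (perm \<pi>) \<psi> = (\<lambda>i. if i \<in> B then \<psi> (\<pi> i) else 0)"
proof
  fix i
  have "(\<Sum>j\<in>B. (if j = \<pi> i then 1 else 0) * \<psi> j) = \<psi> (\<pi> i)" if "i \<in> B"
  proof -
    have "(\<Sum>j\<in>B. (if j = \<pi> i then 1 else 0) * \<psi> j) = (\<Sum>j\<in>B. if j = \<pi> i then \<psi> j else 0)"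
      by (intro sum.cong refl) simp
    thus ?thesis using assms that by simp
  qed
  thus "app B (perm \<pi>) \<psi> i = (if i \<in> B then \<psi> (\<pi> i) else 0)"
    by (simp add: app_def perm_def)
qed

lemma idm_perm: "idm = perm (\<lambda>i. i)"
  by (intro ext) (auto simp: idm_def perm_def)

lemma uni_idm: "finite B \<Longrightarrow> uni B idm"
  unfolding idm_perm by (rule uni_perm) (auto simp: bij_betw_def)

lemma app_idm: "finite B \<Longrightarrow> supported B \<psi> \<Longrightarrow> app B idm \<psi> = \<psi>"
  unfolding idm_perm by (subst app_perm) (auto simp: supported_def)

lemma refl_mat_square:
  assumes "finite B" "i \<in> B" "j \<in> B" "(\<Sum>k\<in>B. P i k * P k j) = P i j"
  shows "(\<Sum>k\<in>B. refl_mat P i k * refl_mat P k j) = (if i = j then 1 else 0)"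
proof -
  have "(\<Sum>k\<in>B. refl_mat P i k * refl_mat P k j)
     = (\<Sum>k\<in>B. (if i = k then (if k = j then 1 else 0) else 0) - (if i = k then 2 * P k j else 0)
          - (if k = j then 2 * P i k else 0) + 4 * (P i k * P k j))"
    by (intro sum.cong refl) (simp add: refl_mat_def algebra_simps)
  also have "\<dots> = (if i = j then 1 else 0) - 2 * P i j - 2 * P i j + 4 * (\<Sum>k\<in>B. P i k * P k j)"
    using assms(1-3) by (simp add: sum.distrib sum_subtractf sum_distrib_left)
  finally show ?thesis using assms(4) by simp
qed

lemma uni_refl_mat:
  assumes "finite B" "\<And>i j. i \<in> B \<Longrightarrow> j \<in> B \<Longrightarrow> cnj (P j i) = P i j"
    "\<And>i j. i \<in> B \<Longrightarrow> j \<in> B \<Longrightarrow> (\<Sum>k\<in>B. P i k * P k j) = P i j"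
  shows "uni B (refl_mat P)"
  unfolding uni_def
proof (intro ballI)
  fix i j assume ij: "i \<in> B" "j \<in> B"
  have "(\<Sum>k\<in>B. cnj (refl_mat P k i) * refl_mat P k j) = (\<Sum>k\<in>B. refl_mat P i k * refl_mat P k j)"
    using assms(2) ij by (intro sum.cong refl) (auto simp: refl_mat_def)
  thus "(\<Sum>k\<in>B. cnj (refl_mat P k i) * refl_mat P k j) = (if i = j then 1 else 0)"
    using refl_mat_square[of B i j P] assms(1,3) ij by simp
qed

lemma app_refl_mat_involution:
  assumes "finite B" "supported B \<psi>"
    "\<And>i j. i \<in> B \<Longrightarrow> j \<in> B \<Longrightarrow> (\<Sum>k\<in>B. P i k * P k j) = P i j"
  shows "app B (refl_mat P) (app B (refl_mat P) \<psi>) = \<psi>"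
proof -
  have "app B (mat_mul B (refl_mat P) (refl_mat P)) \<psi> = app B idm \<psi>"
    using refl_mat_square[OF assms(1) _ _ assms(3)]
    by (intro ext) (auto simp: app_def mat_mul_def idm_def intro!: sum.cong)
  thus ?thesis using assms(1,2) by (simp add: app_mat_mul app_idm)
qed

definition proj_mat :: "('a \<Rightarrow> complex) \<Rightarrow> 'a \<Rightarrow> 'a \<Rightarrow> complex" where
  "proj_mat v = (\<lambda>i j. v i * cnj (v j))"

lemma proj_mat_idem:
  assumes "ip B v v = 1"
  shows "(\<Sum>k\<in>B. proj_mat v i k * proj_mat v k j) = proj_mat v i j"
proof -
  have "(\<Sum>k\<in>B. proj_mat v i k * proj_mat v k j) = v i * cnj (v j) * ip B v v"
    by (simp add: proj_mat_def ip_def sum_distrib_left algebra_simps)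
  thus ?thesis using assms by (simp add: proj_mat_def)
qed

lemma uni_refl_proj: "finite B \<Longrightarrow> ip B v v = 1 \<Longrightarrow> uni B (refl_mat (proj_mat v))"
  by (rule uni_refl_mat) (simp_all add: proj_mat_idem, simp add: proj_mat_def)

lemma app_refl_proj:
  assumes "finite B" "supported B \<psi>" "supported B v"
  shows "app B (refl_mat (proj_mat v)) \<psi> = (\<lambda>i. \<psi> i - 2 * ip B v \<psi> * v i)"
proof
  fix i
  have "(\<Sum>j\<in>B. refl_mat (proj_mat v) i j * \<psi> j)
      = (\<Sum>j\<in>B. (if i = j then \<psi> j else 0) - 2 * v i * (cnj (v j) * \<psi> j))"
    by (intro sum.cong refl) (simp add: refl_mat_def proj_mat_def algebra_simps)
  also have "\<dots> = (\<Sum>j\<in>B. if i = j then \<psi> j else 0) - 2 * v i * ip B v \<psi>"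
    by (simp add: sum_subtractf sum_distrib_left ip_def)
  finally show "app B (refl_mat (proj_mat v)) \<psi> i = \<psi> i - 2 * ip B v \<psi> * v i"
    using assms by (auto simp: app_def supported_def)
qed

lemma app_lin: "app B U (\<lambda>i. a * \<phi> i + b * \<psi> i) = (\<lambda>i. a * app B U \<phi> i + b * app B U \<psi> i)"
  by (intro ext) (simp add: app_def sum.distrib sum_distrib_left algebra_simps)

lemma ip_self: "ip B \<psi> \<psi> = of_real (\<Sum>i\<in>B. (cmod (\<psi> i))\<^sup>2)"
  by (simp only: ip_def of_real_sum complex_norm_square mult.commute)

lemma ip_cnj: "cnj (ip B \<phi> \<psi>) = ip B \<psi> \<phi>"
  by (simp add: ip_def mult.commute)

lemma ip_lin_right: "ip B \<theta> (\<lambda>i. a * \<phi> i + b * \<psi> i) = a * ip B \<theta> \<phi> + b * ip B \<theta> \<psi>"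
  by (simp add: ip_def sum.distrib sum_distrib_left algebra_simps)

text \<open>A Householder reflection along \<open>e - v\<close>; it exchanges the unit vectors \<open>e\<close> and \<open>v\<close>
  because \<open>v r\<close> is real.\<close>

lemma ex_uni_first_column:
  assumes "finite B" "r \<in> B" "supported B v" "ip B v v = 1" "Im (v r) = 0"
  shows "\<exists>U. uni B U \<and> app B U (\<lambda>i. if i = r then 1 else 0) = v"
proof -
  let ?e = "\<lambda>i. if i = r then 1 else (0::complex)"
  have se: "supported B ?e" using assms(2) by (auto simp: supported_def)
  define w where "w = (\<lambda>i. 1 * ?e i + (-1) * v i)"
  have sw: "supported B w" using se assms(3) by (auto simp: supported_def w_def)
  have eX: "ip B ?e \<psi> = \<psi> r" for \<psi>
  proof -
    have "ip B ?e \<psi> = (\<Sum>i\<in>B. if i = r then \<psi> i else 0)"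
      unfolding ip_def by (intro sum.cong refl) auto
    thus ?thesis using assms(1,2) by simp
  qed
  have rv: "v r = of_real (Re (v r))" using assms(5) by (simp add: complex_eq_iff)
  have cv: "cnj (v r) = v r" using rv by (metis complex_cnj_complex_of_real)
  have Xe: "ip B \<psi> ?e = cnj (\<psi> r)" for \<psi> using eX[of \<psi>] ip_cnj[of B ?e \<psi>] by simp
  have we: "ip B w ?e = 1 - v r" by (subst Xe) (simp add: w_def cv)
  have wv: "ip B w v = v r - 1"
  proof -
    have "ip B v w = 1 * ip B v ?e + (-1) * ip B v v" unfolding w_def by (rule ip_lin_right)
    hence "ip B v w = v r - 1" using Xe[of v] cv assms(4) by simp
    thus ?thesis using ip_cnj[of B v w] cv by simp
  qed
  have ww: "ip B w w = 2 * (1 - v r)"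
  proof -
    have "ip B w w = 1 * ip B w ?e + (-1) * ip B w v"
      by (subst (2) w_def) (rule ip_lin_right)
    thus ?thesis using we wv by simp
  qed
  show ?thesis
  proof (cases "v r = 1")
    \<comment> \<open>Here e - v has norm 0 and cannot be normalised, but then v is e and the
      identity serves.\<close>
    case True
    hence "(\<Sum>i\<in>B. (cmod (w i))\<^sup>2) = 0"
      using ww ip_self[of B w] by (metis diff_self mult_zero_right of_real_eq_0_iff)
    hence "\<forall>i\<in>B. w i = 0" using assms(1) by (simp add: sum_nonneg_eq_0_iff)
    hence "?e = v" using se assms(3) by (intro ext) (auto simp: w_def supported_def split: if_splits)
    thus ?thesis using uni_idm[OF assms(1)] app_idm[OF assms(1) se] by auto
  next
    case False
    define s where "s = (\<Sum>i\<in>B. (cmod (w i))\<^sup>2)"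
    have s: "of_real s = 2 * (1 - v r)" using ww ip_self[of B w] by (simp add: s_def)
    have "s \<ge> 0" unfolding s_def by (intro sum_nonneg) auto
    moreover have "s \<noteq> 0" using s False by auto
    ultimately have s0: "s > 0" by simp
    define c where "c = complex_of_real (1 / sqrt s)"
    have cc: "c * c = 1 / of_real s"
    proof -
      have "sqrt s * sqrt s = s" using s0 by simp
      thus ?thesis unfolding c_def by (metis of_real_divide of_real_mult of_real_1 times_divide_times_eq mult_1)
    qed
    have cr: "cnj c = c" by (simp add: c_def)
    define u where "u = (\<lambda>i. c * w i)"
    have su: "supported B u" using sw by (auto simp: u_def supported_def)
    have ipu: "ip B u \<psi> = c * ip B w \<psi>" for \<psi>
      by (simp add: u_def ip_def sum_distrib_left cr mult.assoc)
    have "ip B u u = c * (c * ip B w w)"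
      by (simp add: ipu) (simp add: u_def ip_def sum_distrib_left mult.left_commute)
    also have "\<dots> = 1" using cc ww s s0 False by (simp add: mult.assoc[symmetric])
    finally have u1: "ip B u u = 1" .
    have "app B (refl_mat (proj_mat u)) ?e = (\<lambda>i. ?e i - 2 * ip B u ?e * u i)"
      by (rule app_refl_proj[OF assms(1) se su])
    also have "\<dots> = v"
    proof
      fix i
      \<comment> \<open>The scaling \<open>c * c\<close> = 1/s cancels s = 2 (1 - v r), the squared
        norm of e - v, so exactly w is subtracted.\<close>
      have "2 * ip B u ?e * u i = (c * c) * (2 * (1 - v r)) * w i"
        by (simp only: ipu we) (simp add: u_def)
      also have "\<dots> = w i" using cc s s0 False by simp
      finally show "?e i - 2 * ip B u ?e * u i = v i" by (simp add: w_def)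
    qed
    finally show ?thesis using uni_refl_proj[OF assms(1) u1] by blast
  qed
qed

text \<open>Hypothesis \<open>rec\<close> is the characteristic equation of a rotation by \<phi>,
  applied to v. It propagates to all powers by linearity, so the inner products obey the Chebyshev
  recurrence of cos(k \<phi>).\<close>

lemma walk_cos:
  assumes "finite B" "ip B v v = 1"
    and c: "ip B v (app B U v) = of_real (cos \<phi>)"
    and rec: "app B U (app B U v) = (\<lambda>i. of_real (2 * cos \<phi>) * app B U v i + (-1) * v i)"
  shows "ip B v ((app B U ^^ k) v) = of_real (cos (real k * \<phi>))"
proof -
  have step: "(app B U ^^ Suc (Suc k)) v =
      (\<lambda>i. of_real (2 * cos \<phi>) * (app B U ^^ Suc k) v i + (-1) * (app B U ^^ k) v i)" for k
  proof (induction k)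
    case 0
    show ?case using rec by simp
  next
    case (Suc k)
    have "(app B U ^^ Suc (Suc (Suc k))) v = app B U ((app B U ^^ Suc (Suc k)) v)" by simp
    also have "\<dots> = app B U (\<lambda>i. of_real (2 * cos \<phi>) * (app B U ^^ Suc k) v i + (-1) * (app B U ^^ k) v i)"
      by (simp only: Suc.IH)
    also have "\<dots> = (\<lambda>i. of_real (2 * cos \<phi>) * app B U ((app B U ^^ Suc k) v) i + (-1) * app B U ((app B U ^^ k) v) i)"
      by (rule app_lin)
    finally show ?case by simp
  qed
  show ?thesis
  proof (induction k rule: induct_nat_012)
    case 0 thus ?case using assms by simp
  next
    case 1 thus ?case using c by simp
  next
    case (ge2 n)
    have "cos (real (Suc (Suc n)) * \<phi>) = 2 * cos \<phi> * cos (real (Suc n) * \<phi>) - cos (real n * \<phi>)"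
    proof -
      have "cos ((real n + 1) * \<phi> + \<phi>) + cos ((real n + 1) * \<phi> - \<phi>) = 2 * cos \<phi> * cos ((real n + 1) * \<phi>)"
        by (simp add: cos_add cos_diff)
      thus ?thesis by (simp add: algebra_simps)
    qed
    thus ?case unfolding step ip_lin_right ge2 by simp
  qed
qed

section \<open>Query circuits\<close>

definition reg :: "nat \<Rightarrow> nat \<Rightarrow> 'w set \<Rightarrow> (nat \<times> nat \<times> 'w) set" where
  "reg d b W = {..<d} \<times> {..<2 ^ b} \<times> W"

definition ask :: "(nat \<Rightarrow> nat) \<Rightarrow> nat \<times> nat \<times> 'w \<Rightarrow> nat \<times> nat \<times> 'w" where
  "ask X = (\<lambda>(j, z, w). (j, xor z (X j), w))"

text \<open>A \<open>Gate\<close> carries a fixed matrix, so independence of the input is syntactic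
  and the queries of a circuit can be counted.\<close>

datatype 'w gate = Query | Gate "nat \<times> nat \<times> 'w \<Rightarrow> nat \<times> nat \<times> 'w \<Rightarrow> complex"

fun gate_mat :: "(nat \<Rightarrow> nat) \<Rightarrow> 'w gate \<Rightarrow> nat \<times> nat \<times> 'w \<Rightarrow> nat \<times> nat \<times> 'w \<Rightarrow> complex" where
  "gate_mat X Query = perm (ask X)"
| "gate_mat X (Gate U) = U"

definition run :: "(nat \<times> nat \<times> 'w) set \<Rightarrow> (nat \<Rightarrow> nat) \<Rightarrow> 'w gate list \<Rightarrow>
    (nat \<times> nat \<times> 'w \<Rightarrow> complex) \<Rightarrow> nat \<times> nat \<times> 'w \<Rightarrow> complex" where
  "run B X gs \<psi> = fold (\<lambda>g. app B (gate_mat X g)) gs \<psi>"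

definition queries :: "'w gate list \<Rightarrow> nat" where
  "queries gs = length (filter (\<lambda>g. g = Query) gs)"

definition gates_ok :: "(nat \<times> nat \<times> 'w) set \<Rightarrow> 'w gate list \<Rightarrow> bool" where
  "gates_ok B gs \<longleftrightarrow> (\<forall>U. Gate U \<in> set gs \<longrightarrow> uni B U)"

lemma run_simps [simp]:
  "run B X [] \<psi> = \<psi>"
  "run B X (g # gs) \<psi> = run B X gs (app B (gate_mat X g) \<psi>)"
  "run B X (gs @ hs) \<psi> = run B X hs (run B X gs \<psi>)"
  by (simp_all add: run_def)

lemma queries_simps [simp]:
  "queries [] = 0"
  "queries (Query # gs) = Suc (queries gs)"
  "queries (Gate U # gs) = queries gs"
  "queries (gs @ hs) = queries gs + queries hs"
  "queries (rev gs) = queries gs"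
  by (simp_all add: queries_def rev_filter[symmetric])

lemma gates_ok_simps [simp]:
  "gates_ok B []"
  "gates_ok B (Query # gs) \<longleftrightarrow> gates_ok B gs"
  "gates_ok B (Gate U # gs) \<longleftrightarrow> uni B U \<and> gates_ok B gs"
  "gates_ok B (gs @ hs) \<longleftrightarrow> gates_ok B gs \<and> gates_ok B hs"
  "gates_ok B (rev gs) \<longleftrightarrow> gates_ok B gs"
  by (auto simp: gates_ok_def)

lemma finite_reg [simp]: "finite W \<Longrightarrow> finite (reg d b W)"
  by (simp add: reg_def)

lemma xor_less_power:
  assumes "x < 2 ^ b" "y < (2::nat) ^ b"
  shows "xor x y < 2 ^ b"
proof -
  have "take_bit b (xor x y) = xor x y"
    using assms by (simp add: take_bit_xor take_bit_nat_eq_self)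
  thus ?thesis by (metis take_bit_nat_less_exp)
qed

lemma ask_involution [simp]: "ask X (ask X i) = i"
  by (cases i) (simp add: ask_def xor.assoc)

lemma ask_reg: "valid_input d b X \<Longrightarrow> i \<in> reg d b W \<Longrightarrow> ask X i \<in> reg d b W"
  by (auto simp: ask_def reg_def valid_input_def xor_less_power)

lemma bij_betw_involution:
  assumes "\<And>i. i \<in> B \<Longrightarrow> f i \<in> B" "\<And>i. i \<in> B \<Longrightarrow> f (f i) = i"
  shows "bij_betw f B B"
  by (rule bij_betw_byWitness[where f' = f]) (use assms in auto)

lemma uni_gate_mat:
  assumes "valid_input d b X" "finite W" "gates_ok (reg d b W) gs" "g \<in> set gs"
  shows "uni (reg d b W) (gate_mat X g)"
proof (cases g)
  case Query
  thus ?thesis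
    using assms by (auto intro!: uni_perm bij_betw_involution ask_reg)
next
  case (Gate U)
  thus ?thesis using assms by (auto simp: gates_ok_def)
qed

lemma supported_run: "supported B \<psi> \<Longrightarrow> supported B (run B X gs \<psi>)"
  by (induction gs arbitrary: \<psi>) auto

text \<open>For analysis only: U depends on X. Vectors must be supported on the basis because
  \<open>app\<close> vanishes outside it, so even the empty circuit is a matrix only on such
  vectors.\<close>

lemma run_eq_app:
  assumes "valid_input d b X" "finite W" "gates_ok (reg d b W) gs"
  shows "\<exists>U. uni (reg d b W) U \<and>
    (\<forall>\<psi>. supported (reg d b W) \<psi> \<longrightarrow> run (reg d b W) X gs \<psi> = app (reg d b W) U \<psi>)"
  using assms(3)
proof (induction gs)
  case Nil
  have "uni (reg d b W) idm" using assms by (intro uni_idm) simp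
  thus ?case using assms by (intro exI[of _ idm]) (simp add: app_idm)
next
  case (Cons g gs)
  have "gates_ok (reg d b W) gs" using Cons.prems by (auto simp: gates_ok_def)
  then obtain U where U: "uni (reg d b W) U"
    "\<And>\<psi>. supported (reg d b W) \<psi> \<Longrightarrow> run (reg d b W) X gs \<psi> = app (reg d b W) U \<psi>"
    using Cons.IH by auto
  have "uni (reg d b W) (mat_mul (reg d b W) U (gate_mat X g))"
    using assms U(1) Cons.prems by (intro uni_mat_mul uni_gate_mat[of d b X W "g # gs"]) auto
  moreover have "run (reg d b W) X (g # gs) \<psi> = app (reg d b W) (mat_mul (reg d b W) U (gate_mat X g)) \<psi>" for \<psi>
    using U(2)[of "app (reg d b W) (gate_mat X g) \<psi>"] by (simp add: app_mat_mul)
  ultimately show ?case by blast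
qed

text \<open>Built from the end of the circuit: a final gate is multiplied into the last unitary, a
  final query opens a new round with the identity. U and Us are chosen before X, as the model
  demands.\<close>

lemma run_normal_form:
  assumes "finite W" "gates_ok (reg d b W) gs"
  shows "\<exists>U Us. length Us = queries gs \<and> (\<forall>V\<in>set (U # Us). uni (reg d b W) V) \<and>
    (\<forall>X \<psi>. supported (reg d b W) \<psi> \<longrightarrow> run (reg d b W) X gs \<psi> =
       fold (\<lambda>V \<phi>. app (reg d b W) V (app (reg d b W) (perm (ask X)) \<phi>)) Us (app (reg d b W) U \<psi>))"
  using assms(2)
proof (induction gs rule: rev_induct)
  case Nil
  show ?case using assms(1)
    by (intro exI[of _ idm] exI[of _ "[]"]) (simp add: uni_idm app_idm)
next
  case (snoc g gs)
  let ?B = "reg d b W"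
  obtain U Us where U: "length Us = queries gs" "\<forall>V\<in>set (U # Us). uni ?B V"
    "\<And>X \<psi>. supported ?B \<psi> \<Longrightarrow> run ?B X gs \<psi> =
       fold (\<lambda>V \<phi>. app ?B V (app ?B (perm (ask X)) \<phi>)) Us (app ?B U \<psi>)"
    using snoc by fastforce
  show ?case
  proof (cases g)
    case Query
    thus ?thesis using U assms(1)
      by (intro exI[of _ U] exI[of _ "Us @ [idm]"]) (auto simp: uni_idm app_idm)
  next
    case (Gate V)
    have V: "uni ?B V" using snoc.prems Gate by simp
    show ?thesis
    proof (cases Us rule: rev_cases)
      case Nil
      thus ?thesis using U assms(1) V Gate
        by (intro exI[of _ "mat_mul ?B V U"] exI[of _ "[]"]) (auto simp: uni_mat_mul app_mat_mul)
    next
      case (snoc Us' V')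
      thus ?thesis using U assms(1) V Gate
        by (intro exI[of _ U] exI[of _ "Us' @ [mat_mul ?B V V']"]) (auto simp: uni_mat_mul app_mat_mul)
    qed
  qed
qed

text \<open>Workspaces may be arbitrary finite sets; relabelling them by numbers gives an
  algorithm in the sense of the query model.\<close>

lemma query_alg_of_run:
  fixes W :: "'w set" and out :: "nat \<times> nat \<times> 'w \<Rightarrow> 'o"
  assumes "finite W" "w0 \<in> W" "0 < d" "gates_ok (reg d b W) gs"
  shows "\<exists>M U Us out'. is_query_alg d b M U Us \<and> length Us = queries gs \<and>
    (\<forall>X f S. valid_input d b X \<longrightarrow> out_prob d b M U Us (\<lambda>i. f (out' i :: 'o)) X S =
       (\<Sum>i\<in>{i\<in>reg d b W. f (out i) \<in> S}.
          (cmod (run (reg d b W) X gs (\<lambda>i. if i = (0, 0, w0) then 1 else 0) i))\<^sup>2))"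
proof -
  let ?B = "reg d b W"
  define M where "M = card W"
  obtain e0 where e0: "bij_betw e0 {..<M} W"
    using ex_bij_betw_nat_finite[OF assms(1)] by (auto simp: M_def atLeast0LessThan)
  have M0: "0 < M" using assms by (auto simp: M_def card_gt_0_iff)
  obtain k where k: "k < M" "e0 k = w0"
    using e0 assms(2) by (auto simp: bij_betw_def)
  define e where "e = e0 \<circ> Transposition.transpose 0 k"
  have e: "bij_betw e {..<M} W"
    unfolding e_def using M0 k e0
    by (intro bij_betw_trans[OF _ e0] bij_betw_involution) (auto simp: Transposition.transpose_def)
  have ew: "e 0 = w0" using k by (simp add: e_def)
  define D where "D = (\<lambda>(j::nat, z::nat, w). (j, z, e w))"
  have D: "bij_betw D (qbasis d b M) ?B"
  proof -
    have "D = map_prod id (map_prod id e)" by (auto simp: D_def)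
    thus ?thesis using e unfolding qbasis_def reg_def
      by (auto intro!: bij_betw_map_prod bij_betw_id)
  qed
  have DB: "i \<in> qbasis d b M \<Longrightarrow> D i \<in> ?B" for i using D by (auto simp: bij_betw_def)
  have Dinj: "i \<in> qbasis d b M \<Longrightarrow> j \<in> qbasis d b M \<Longrightarrow> D i = D j \<longleftrightarrow> i = j" for i j
    using D by (auto simp: bij_betw_def inj_on_def)
  obtain U Us where U: "length Us = queries gs" "\<forall>V\<in>set (U # Us). uni ?B V"
    "\<And>X \<psi>. supported ?B \<psi> \<Longrightarrow> run ?B X gs \<psi> =
       fold (\<lambda>V \<phi>. app ?B V (app ?B (perm (ask X)) \<phi>)) Us (app ?B U \<psi>)"
    using run_normal_form[OF assms(1,4)] by blast
  define pull where "pull = (\<lambda>V i j. V (D i) (D j) :: complex)"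
  have pull_uni: "uni (qbasis d b M) (pull V)" if "uni ?B V" for V
    unfolding uni_def
  proof (intro ballI)
    fix i j assume ij: "i \<in> qbasis d b M" "j \<in> qbasis d b M"
    have "(\<Sum>k\<in>qbasis d b M. cnj (pull V k i) * pull V k j)
        = (\<Sum>k\<in>qbasis d b M. (\<lambda>k. cnj (V k (D i)) * V k (D j)) (D k))"
      by (simp add: pull_def)
    also have "\<dots> = (\<Sum>k\<in>?B. cnj (V k (D i)) * V k (D j))"
      by (rule sum.reindex_bij_betw[OF D])
    also have "\<dots> = (if i = j then 1 else 0)"
      using that ij DB Dinj by (simp add: uni_def)
    finally show "(\<Sum>k\<in>qbasis d b M. cnj (pull V k i) * pull V k j) = (if i = j then 1 else 0)" .
  qed
  define rest where "rest = (\<lambda>\<psi> i. if i \<in> qbasis d b M then \<psi> (D i) else (0::complex))"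
  have pull_app: "app (qbasis d b M) (pull V) (rest \<psi>) = rest (app ?B V \<psi>)" for V \<psi>
  proof
    fix i
    have "(\<Sum>j\<in>qbasis d b M. pull V i j * rest \<psi> j) = (\<Sum>j\<in>qbasis d b M. (\<lambda>j. V (D i) j * \<psi> j) (D j))"
      by (intro sum.cong) (auto simp: pull_def rest_def)
    also have "\<dots> = (\<Sum>j\<in>?B. V (D i) j * \<psi> j)"
      by (rule sum.reindex_bij_betw[OF D])
    finally show "app (qbasis d b M) (pull V) (rest \<psi>) i = rest (app ?B V \<psi>) i"
      using DB by (auto simp: app_def rest_def)
  qed
  have pull_oracle: "oracle_op (qbasis d b M) X (rest \<psi>) = rest (app ?B (perm (ask X)) \<psi>)"
    if X: "valid_input d b X" for X \<psi>
  proof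
    fix i :: basis
    obtain j z w where i: "i = (j, z, w)" by (cases i)
    have *: "app ?B (perm (ask X)) \<psi> = (\<lambda>i. if i \<in> ?B then \<psi> (ask X i) else 0)"
      using assms(1) ask_reg[OF X] by (intro app_perm) auto
    have "(j, xor z (X j), w) \<in> qbasis d b M" if "i \<in> qbasis d b M"
      using that X i by (auto simp: qbasis_def valid_input_def xor_less_power)
    moreover have ask_D: "ask X (D (j, z, w)) = D (j, xor z (X j), w)"
      by (simp add: D_def ask_def)
    ultimately show "oracle_op (qbasis d b M) X (rest \<psi>) i = rest (app ?B (perm (ask X)) \<psi>) i"
      using DB[of i] ask_D by (auto simp: oracle_op_def rest_def * i)
  qed
  let ?init = "\<lambda>i. if i = (0, 0, w0) then 1 else (0::complex)"
  have oB: "(0, 0, w0) \<in> ?B" and oq: "(0, 0, 0) \<in> qbasis d b M"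
    using assms M0 by (auto simp: reg_def qbasis_def)
  have init: "init_state = rest ?init"
  proof
    fix i
    have "D i = (0, 0, w0) \<longleftrightarrow> i = (0, 0, 0)" if "i \<in> qbasis d b M"
      using Dinj[OF that oq] ew by (auto simp: D_def)
    thus "init_state i = rest ?init i" using oq by (auto simp: init_state_def rest_def)
  qed
  have fin: "final_state d b M (pull U) (map pull Us) X = rest (run ?B X gs ?init)"
    if X: "valid_input d b X" for X
  proof -
    have "fold (\<lambda>V \<phi>. app (qbasis d b M) V (oracle_op (qbasis d b M) X \<phi>)) (map pull Vs) (rest \<psi>)
       = rest (fold (\<lambda>V \<phi>. app ?B V (app ?B (perm (ask X)) \<phi>)) Vs \<psi>)" for Vs \<psi>
      by (induction Vs arbitrary: \<psi>) (simp_all add: pull_oracle[OF X] pull_app)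
    moreover have "supported ?B ?init" using oB by (auto simp: supported_def)
    ultimately show ?thesis
      using U(3) by (simp add: final_state_def apply_op_app init pull_app)
  qed
  have "is_query_alg d b M (pull U) (map pull Us)"
    using U(2) M0 by (auto simp: is_query_alg_def unitary_on_uni pull_uni)
  moreover have "out_prob d b M (pull U) (map pull Us) (\<lambda>i. f (out (D i))) X S =
       (\<Sum>i\<in>{i\<in>?B. f (out i) \<in> S}. (cmod (run ?B X gs ?init i))\<^sup>2)"
    if X: "valid_input d b X" for X f S
  proof -
    have "bij_betw D {i\<in>qbasis d b M. f (out (D i)) \<in> S} {i\<in>?B. f (out i) \<in> S}"
      by (rule bij_betw_subset[OF D]) (auto simp flip: bij_betw_imp_surj_on[OF D])
    from sum.reindex_bij_betw[OF this, of "\<lambda>i. (cmod (run ?B X gs ?init i))\<^sup>2"]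
    show ?thesis by (auto simp: out_prob_def fin[OF X] rest_def intro!: sum.cong)
  qed
  ultimately show ?thesis
    using U(1) by (intro exI[of _ M] exI[of _ "pull U"] exI[of _ "map pull Us"] exI[of _ "\<lambda>i. out (D i)"]) auto
qed

section \<open>Phase estimation\<close>

definition slice :: "nat \<Rightarrow> (nat \<times> nat \<times> nat \<times> 'w \<Rightarrow> 'c) \<Rightarrow> nat \<times> nat \<times> 'w \<Rightarrow> 'c" where
  "slice x \<psi> = (\<lambda>(j, z, w). \<psi> (j, z, x, w))"

definition lift :: "(nat \<Rightarrow> nat \<times> nat \<times> 'w \<Rightarrow> nat \<times> nat \<times> 'w \<Rightarrow> complex) \<Rightarrow>
    nat \<times> nat \<times> nat \<times> 'w \<Rightarrow> nat \<times> nat \<times> nat \<times> 'w \<Rightarrow> complex" where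
  "lift U = (\<lambda>(j, z, x, w) (j', z', x', w'). if x = x' then U x (j, z, w) (j', z', w') else 0)"

definition tensor_fst :: "(nat \<Rightarrow> nat \<Rightarrow> complex) \<Rightarrow>
    nat \<times> nat \<times> nat \<times> 'w \<Rightarrow> nat \<times> nat \<times> nat \<times> 'w \<Rightarrow> complex" where
  "tensor_fst V = (\<lambda>(j, z, x, w) (j', z', x', w'). if (j, z, w) = (j', z', w') then V x x' else 0)"

lemma sum_controlled_reg:
  "(\<Sum>i\<in>reg d b ({..<N} \<times> W). f i) = (\<Sum>x<N. \<Sum>r\<in>reg d b W. slice x f r)"
  (is "?l = _")
proof -
  have "?l = (\<Sum>(x, r)\<in>{..<N} \<times> reg d b W. slice x f r)"
    by (rule sum.reindex_bij_witness[where j = "\<lambda>(j, z, x, w). (x, j, z, w)"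
          and i = "\<lambda>(x, j, z, w). (j, z, x, w)"]) (auto simp: reg_def slice_def)
  thus ?thesis by (simp add: sum.cartesian_product)
qed

lemma slice_apply: "slice x \<psi> (j, z, w) = \<psi> (j, z, x, w)"
  by (simp add: slice_def)

lemma slice_app_lift:
  assumes "finite W" "x < N"
  shows "slice x (app (reg d b ({..<N} \<times> W)) (lift U) \<psi>) = app (reg d b W) (U x) (slice x \<psi>)"
proof
  fix r :: "nat \<times> nat \<times> 'a"
  obtain j z w where r: "r = (j, z, w)" by (cases r)
  have "(\<Sum>i\<in>reg d b ({..<N} \<times> W). lift U (j, z, x, w) i * \<psi> i)
      = (\<Sum>x'<N. if x' = x then (\<Sum>s\<in>reg d b W. U x (j, z, w) s * slice x \<psi> s) else 0)"
    unfolding sum_controlled_reg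
    by (intro sum.cong HOL.refl) (auto simp: slice_def lift_def intro!: sum.cong)
  also have "\<dots> = (\<Sum>s\<in>reg d b W. U x (j, z, w) s * slice x \<psi> s)"
    using assms(2) by simp
  finally show "slice x (app (reg d b ({..<N} \<times> W)) (lift U) \<psi>) r = app (reg d b W) (U x) (slice x \<psi>) r"
    using assms(2) by (simp add: r slice_apply app_def reg_def)
qed

lemma uni_lift:
  assumes "finite W" "\<And>x. x < N \<Longrightarrow> uni (reg d b W) (U x)"
  shows "uni (reg d b ({..<N} \<times> W)) (lift U)"
  unfolding uni_def
proof (intro ballI)
  fix i i' :: "nat \<times> nat \<times> nat \<times> 'a"
  assume *: "i \<in> reg d b ({..<N} \<times> W)" "i' \<in> reg d b ({..<N} \<times> W)"
  obtain j z x w j' z' x' w' where i: "i = (j, z, x, w)" "i' = (j', z', x', w')"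
    by (metis prod_cases4)
  have r: "x < N" "(j, z, w) \<in> reg d b W" "(j', z', w') \<in> reg d b W"
    using * by (auto simp: i reg_def)
  have "(\<Sum>k\<in>reg d b ({..<N} \<times> W). cnj (lift U k i) * lift U k i')
     = (\<Sum>y<N. if y = x then (if x = x' then
          (\<Sum>s\<in>reg d b W. cnj (U x s (j, z, w)) * U x s (j', z', w')) else 0) else 0)"
    unfolding sum_controlled_reg
    by (intro sum.cong HOL.refl) (auto simp: slice_def lift_def i intro!: sum.cong)
  also have "\<dots> = (if i = i' then 1 else 0)"
    using assms(2)[OF r(1)] r by (auto simp: uni_def i)
  finally show "(\<Sum>k\<in>reg d b ({..<N} \<times> W). cnj (lift U k i) * lift U k i') = (if i = i' then 1 else 0)" .
qed

lemma app_tensor_fst: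
  assumes "finite W" "y < N"
  shows "slice y (app (reg d b ({..<N} \<times> W)) (tensor_fst V) \<psi>) =
    (\<lambda>r. if r \<in> reg d b W then (\<Sum>x<N. V y x * slice x \<psi> r) else 0)"
proof
  fix r :: "nat \<times> nat \<times> 'a"
  obtain j z w where r: "r = (j, z, w)" by (cases r)
  have "(\<Sum>i\<in>reg d b ({..<N} \<times> W). tensor_fst V (j, z, y, w) i * \<psi> i)
      = (\<Sum>x<N. \<Sum>s\<in>reg d b W. if s = r then V y x * slice x \<psi> r else 0)"
    unfolding sum_controlled_reg
    by (intro sum.cong HOL.refl) (auto simp: slice_def tensor_fst_def r split: if_splits)
  also have "\<dots> = (\<Sum>x<N. V y x * slice x \<psi> r)" if "r \<in> reg d b W"
    using assms(1) that by simp
  finally show "slice y (app (reg d b ({..<N} \<times> W)) (tensor_fst V) \<psi>) r =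
      (if r \<in> reg d b W then (\<Sum>x<N. V y x * slice x \<psi> r) else 0)"
    using assms(2) by (auto simp: r slice_apply app_def reg_def)
qed

lemma uni_tensor_fst:
  assumes "finite W" "uni {..<N} V"
  shows "uni (reg d b ({..<N} \<times> W)) (tensor_fst V)"
  unfolding uni_def
proof (intro ballI)
  fix i i' :: "nat \<times> nat \<times> nat \<times> 'a"
  assume *: "i \<in> reg d b ({..<N} \<times> W)" "i' \<in> reg d b ({..<N} \<times> W)"
  obtain j z x w j' z' x' w' where i: "i = (j, z, x, w)" "i' = (j', z', x', w')"
    by (metis prod_cases4)
  have r: "x < N" "x' < N" "(j, z, w) \<in> reg d b W" "(j', z', w') \<in> reg d b W"
    using * by (auto simp: i reg_def)
  have "(\<Sum>k\<in>reg d b ({..<N} \<times> W). cnj (tensor_fst V k i) * tensor_fst V k i')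
     = (\<Sum>y<N. \<Sum>s\<in>reg d b W. if s = (j, z, w) then (if s = (j', z', w') then cnj (V y x) * V y x' else 0) else 0)"
    unfolding sum_controlled_reg
    by (intro sum.cong HOL.refl) (auto simp: slice_def tensor_fst_def i split: if_splits)
  also have "\<dots> = (if (j, z, w) = (j', z', w') then (\<Sum>y<N. cnj (V y x) * V y x') else 0)"
    using assms(1) r by (cases "(j, z, w) = (j', z', w')") auto
  also have "\<dots> = (if i = i' then 1 else 0)"
    using assms(2) r by (auto simp: uni_def i)
  finally show "(\<Sum>k\<in>reg d b ({..<N} \<times> W). cnj (tensor_fst V k i) * tensor_fst V k i') = (if i = i' then 1 else 0)" .
qed

text \<open>What is left of a gate whose control is off: a fixed matrix can be replaced by the
  identity, a query cannot.\<close>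

fun blank :: "'w gate \<Rightarrow> 'w gate" where
  "blank Query = Query"
| "blank (Gate U) = Gate idm"

fun ctrl :: "nat \<Rightarrow> 'w gate \<Rightarrow> (nat \<times> 'w) gate" where
  "ctrl s Query = Query"
| "ctrl s (Gate U) = Gate (lift (\<lambda>x. if s \<le> x then U else idm))"

lemma gate_mat_ctrl:
  "gate_mat X (ctrl s g) = lift (\<lambda>x. if s \<le> x then gate_mat X g else gate_mat X (blank g))"
  by (cases g) (auto simp: lift_def perm_def ask_def fun_eq_iff)

lemma slice_run_ctrl:
  assumes "finite W" "x < N"
  shows "slice x (run (reg d b ({..<N} \<times> W)) X (map (ctrl s) gs) \<psi>) =
    run (reg d b W) X (if s \<le> x then gs else map blank gs) (slice x \<psi>)"
proof (induction gs arbitrary: \<psi>)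
  case (Cons g gs)
  show ?case
    by (simp add: Cons.IH gate_mat_ctrl slice_app_lift[OF assms])
qed simp

text \<open>Blanked circuits still issue queries, which cancel in pairs.\<close>

lemma run_blank:
  assumes X: "valid_input d b X" and W: "finite W" and \<psi>: "supported (reg d b W) \<psi>"
  shows "run (reg d b W) X (map blank gs) \<psi> =
    (if even (queries gs) then \<psi> else app (reg d b W) (perm (ask X)) \<psi>)"
  using \<psi>
proof (induction gs arbitrary: \<psi>)
  case (Cons g gs)
  show ?case
  proof (cases g)
    case Query
    have "app (reg d b W) (perm (ask X)) (app (reg d b W) (perm (ask X)) \<psi>) = \<psi>"
      using W Cons.prems ask_reg[OF X, of _ W]
      by (subst (1 2) app_perm) (auto simp: supported_def fun_eq_iff)
    thus ?thesis using Cons Query by simp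
  next
    case (Gate U)
    thus ?thesis using Cons W by (simp add: app_idm)
  qed
qed simp

lemma queries_map_ctrl [simp]: "queries (map (ctrl s) gs) = queries gs"
proof (induction gs)
  case (Cons g gs)
  thus ?case by (cases g) auto
qed simp

lemma gates_ok_map_ctrl:
  assumes "finite W" "gates_ok (reg d b W) gs"
  shows "gates_ok (reg d b ({..<N} \<times> W)) (map (ctrl s) gs)"
  using assms(2)
proof (induction gs)
  case (Cons g gs)
  thus ?case using assms(1) by (cases g) (auto intro!: uni_lift simp: uni_idm)
qed simp

text \<open>Unary control: round s acts exactly on control values x \<ge> s, so value x collects min
  m x applications.\<close>

definition ctrl_powers :: "nat \<Rightarrow> 'w gate list \<Rightarrow> (nat \<times> 'w) gate list" where
  "ctrl_powers m gs = concat (map (\<lambda>s. map (ctrl s) gs) [1..<Suc m])"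

lemma ctrl_powers_Suc: "ctrl_powers (Suc m) gs = ctrl_powers m gs @ map (ctrl (Suc m)) gs"
  by (simp add: ctrl_powers_def)

lemma queries_ctrl_powers: "queries (ctrl_powers m gs) = m * queries gs"
  by (induction m) (simp_all add: ctrl_powers_Suc, simp add: ctrl_powers_def)

lemma gates_ok_ctrl_powers:
  assumes "finite W" "gates_ok (reg d b W) gs"
  shows "gates_ok (reg d b ({..<N} \<times> W)) (ctrl_powers m gs)"
  by (induction m) (simp_all add: ctrl_powers_Suc gates_ok_map_ctrl[OF assms], simp add: ctrl_powers_def)

lemma supported_slice: "supported (reg d b ({..<N} \<times> W)) \<psi> \<Longrightarrow> supported (reg d b W) (slice x \<psi>)"
  by (auto simp: supported_def slice_def reg_def)

text \<open>In a round s > x the slice sees bare queries only. Their number is even, so the round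
  acts as the identity.\<close>

lemma slice_run_ctrl_powers:
  assumes "valid_input d b X" "finite W" "x < N" "even (queries gs)"
    and "supported (reg d b ({..<N} \<times> W)) \<psi>"
  shows "slice x (run (reg d b ({..<N} \<times> W)) X (ctrl_powers m gs) \<psi>) =
    (run (reg d b W) X gs ^^ min m x) (slice x \<psi>)"
proof (induction m)
  case 0
  show ?case by (simp add: ctrl_powers_def)
next
  case (Suc m)
  let ?\<phi> = "slice x (run (reg d b ({..<N} \<times> W)) X (ctrl_powers m gs) \<psi>)"
  have "supported (reg d b W) ?\<phi>"
    by (rule supported_slice[OF supported_run[OF assms(5)]])
  hence "run (reg d b W) X (map blank gs) ?\<phi> = ?\<phi>"
    using run_blank[OF assms(1,2), of ?\<phi> gs] assms(4) by simp
  thus ?case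
    by (auto simp: ctrl_powers_Suc slice_run_ctrl[OF assms(2,3)] Suc min_def not_less_eq_eq le_Suc_eq)
qed

lemma run_scale: "run B X gs (\<lambda>i. c * \<psi> i) = (\<lambda>i. c * run B X gs \<psi> i)"
proof (induction gs arbitrary: \<psi>)
  case (Cons g gs)
  have "app B (gate_mat X g) (\<lambda>i. c * \<psi> i) = (\<lambda>i. c * app B (gate_mat X g) \<psi> i)"
    by (auto simp: app_def sum_distrib_left mult.left_commute)
  thus ?case using Cons by simp
qed simp

lemma run_funpow_scale: "(run B X gs ^^ k) (\<lambda>i. c * \<psi> i) = (\<lambda>i. c * (run B X gs ^^ k) \<psi> i)"
  by (induction k) (simp_all add: run_scale)

section \<open>Outcome statistics of phase estimation\<close>

text \<open>A squared norm depends on the vectors only through their Gram matrix, and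
  cos((x-y)\<theta>) is the mean of exp(i(x-y)\<theta>) and its conjugate. The family thus behaves
  like an even mixture of eigenvectors with phases \<theta> and -\<theta>, even if the span of the u
  x is degenerate.\<close>

lemma sum_norm_equiangular:
  assumes "\<And>x y. x < N \<Longrightarrow> y < N \<Longrightarrow> ip B (u x) (u y) = of_real (cos ((real x - real y) * \<theta>))"
  shows "(\<Sum>r\<in>B. (cmod (\<Sum>x<N. c x * u x r))\<^sup>2) =
    ((cmod (\<Sum>x<N. c x * cis (real x * \<theta>)))\<^sup>2 + (cmod (\<Sum>x<N. c x * cis (- (real x * \<theta>))))\<^sup>2) / 2"
proof -
  define C where "C = (\<Sum>x<N. c x * of_real (cos (real x * \<theta>)))"
  define S where "S = (\<Sum>x<N. c x * of_real (sin (real x * \<theta>)))"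
  have cis: "cis \<alpha> = of_real (cos \<alpha>) + \<i> * of_real (sin \<alpha>)" for \<alpha>
    by (simp add: complex_eq_iff)
  have p: "(\<Sum>x<N. c x * cis (real x * \<theta>)) = C + \<i> * S"
    unfolding C_def S_def sum_distrib_left sum.distrib[symmetric]
    by (rule sum.cong[OF HOL.refl]) (simp add: cis distrib_left mult_ac)
  have m: "(\<Sum>x<N. c x * cis (- (real x * \<theta>))) = C - \<i> * S"
    unfolding C_def S_def sum_distrib_left sum_subtractf[symmetric]
    by (rule sum.cong[OF HOL.refl]) (simp add: cis right_diff_distrib mult_ac)
  have "complex_of_real (\<Sum>r\<in>B. (cmod (\<Sum>x<N. c x * u x r))\<^sup>2)
     = (\<Sum>r\<in>B. \<Sum>x<N. \<Sum>y<N. cnj (c x) * c y * (cnj (u x r) * u y r))"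
    unfolding of_real_sum
  proof (rule sum.cong[OF HOL.refl])
    fix r
    have "complex_of_real ((cmod (\<Sum>x<N. c x * u x r))\<^sup>2) = cnj (\<Sum>x<N. c x * u x r) * (\<Sum>x<N. c x * u x r)"
      by (simp only: complex_norm_square mult.commute)
    also have "\<dots> = (\<Sum>x<N. \<Sum>y<N. cnj (c x) * c y * (cnj (u x r) * u y r))"
      unfolding cnj_sum sum_product by (intro sum.cong HOL.refl) (simp add: mult_ac)
    finally show "complex_of_real ((cmod (\<Sum>x<N. c x * u x r))\<^sup>2) =
      (\<Sum>x<N. \<Sum>y<N. cnj (c x) * c y * (cnj (u x r) * u y r))" .
  qed
  also have "\<dots> = (\<Sum>x<N. \<Sum>y<N. cnj (c x) * c y * ip B (u x) (u y))"
    by (subst sum.swap, rule sum.cong[OF HOL.refl], subst sum.swap)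
      (simp add: ip_def sum_distrib_left)
  also have "\<dots> = (\<Sum>x<N. \<Sum>y<N. cnj (c x) * c y *
       (of_real (cos (real x * \<theta>)) * of_real (cos (real y * \<theta>)) + of_real (sin (real x * \<theta>)) * of_real (sin (real y * \<theta>))))"
    by (intro sum.cong HOL.refl) (simp add: assms left_diff_distrib cos_diff)
  also have "\<dots> = cnj C * C + cnj S * S"
    unfolding C_def S_def cnj_sum sum_product sum.distrib[symmetric]
    by (intro sum.cong HOL.refl) (simp add: distrib_left mult_ac)
  also have "\<dots> = of_real ((cmod C)\<^sup>2 + (cmod S)\<^sup>2)"
    by (simp only: of_real_add complex_norm_square mult.commute)
  finally have "(\<Sum>r\<in>B. (cmod (\<Sum>x<N. c x * u x r))\<^sup>2) = (cmod C)\<^sup>2 + (cmod S)\<^sup>2"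
    using of_real_eq_iff by blast
  \<comment> \<open>Parallelogram law for C and i S.\<close>
  also have "\<dots> = ((cmod (C + \<i> * S))\<^sup>2 + (cmod (C - \<i> * S))\<^sup>2) / 2"
    unfolding cmod_power2 by (simp add: power2_eq_square algebra_simps)
  finally show ?thesis by (simp add: p m)
qed

definition fourier :: "nat \<Rightarrow> nat \<Rightarrow> nat \<Rightarrow> complex" where
  "fourier N y x = cis (- (2 * pi * real x * real y / real N)) / of_real (sqrt (real N))"

lemma sum_roots_of_unity:
  assumes "x < N" "x' < N"
  shows "(\<Sum>y<N. cis (2 * pi * (real x - real x') * real y / real N)) = (if x = x' then of_nat N else 0)"
proof (cases "x = x'")
  case False
  define \<alpha> where "\<alpha> = 2 * pi * (real x - real x') / real N"
  have N: "N > 0" using assms by simp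
  have "cis \<alpha> \<noteq> 1"
  proof
    assume "cis \<alpha> = 1"
    hence "cos \<alpha> = 1" by (metis cis.sel(1) one_complex.sel(1))
    then obtain k :: int where "\<alpha> = of_int k * 2 * pi"
      by (auto simp: cos_one_2pi_int)
    hence "2 * pi * (real x - real x') = 2 * pi * (of_int k * real N)"
      using N by (simp add: \<alpha>_def field_simps)
    hence "real x - real x' = of_int k * real N" by (subst (asm) mult_cancel_left) simp
    hence "int x - int x' = k * int N" by (metis (mono_tags, lifting) of_int_diff of_int_eq_iff of_int_mult of_int_of_nat_eq)
    moreover from this have "k \<noteq> 0" using False by auto
    hence "\<bar>k\<bar> \<ge> 1" by linarith
    hence "\<bar>k * int N\<bar> \<ge> int N" by (simp add: abs_mult mult_le_cancel_right1)
    ultimately show False using assms by linarith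
  qed
  moreover have "cis \<alpha> ^ N = 1"
  proof -
    have "real N * \<alpha> = 2 * pi * of_int (int x - int x')" using N by (simp add: \<alpha>_def)
    hence "cis (real N * \<alpha>) = 1" by (metis cis_multiple_2pi Ints_of_int)
    thus ?thesis by (simp only: Complex.DeMoivre)
  qed
  ultimately have "(\<Sum>y<N. cis \<alpha> ^ y) = 0" by (simp add: sum_gp_strict)
  moreover have "cis \<alpha> ^ y = cis (2 * pi * (real x - real x') * real y / real N)" for y
    by (simp add: Complex.DeMoivre \<alpha>_def mult_ac)
  ultimately show ?thesis using False by simp
qed simp

lemma uni_fourier:
  assumes "0 < N"
  shows "uni {..<N} (fourier N)"
  unfolding uni_def
proof (intro ballI)
  fix i j assume ij: "i \<in> {..<N}" "j \<in> {..<N}"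
  have sN: "of_real (sqrt (real N)) * of_real (sqrt (real N)) = (of_nat N :: complex)"
    by (metis of_real_mult of_real_of_nat_eq real_sqrt_mult_self abs_of_nat)
  have "(\<Sum>k<N. cnj (fourier N k i) * fourier N k j) =
      (\<Sum>k<N. cis (2 * pi * (real i - real j) * real k / real N)) / of_nat N"
    unfolding sum_divide_distrib
    by (intro sum.cong HOL.refl)
      (simp add: fourier_def cis_cnj cis_mult sN diff_divide_distrib algebra_simps)
  thus "(\<Sum>k<N. cnj (fourier N k i) * fourier N k j) = (if i = j then 1 else 0)"
    using sum_roots_of_unity[of i N j] ij assms by simp
qed

text \<open>Outcome distribution of phase estimation on an eigenvector with eigenvalue
  \<open>cis \<theta>\<close>, when the control register starts with amplitudes a.\<close>

definition spec :: "nat \<Rightarrow> (nat \<Rightarrow> complex) \<Rightarrow> real \<Rightarrow> nat \<Rightarrow> real" where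
  "spec N a \<theta> y = (cmod (\<Sum>x<N. fourier N y x * a x * cis (real x * \<theta>)))\<^sup>2"

text \<open>Unitarity lowers both exponents together until one of them is 0; if the first is the
  larger one, conjugation exchanges the roles, and the value is real.\<close>

lemma run_funpow_ip:
  assumes "valid_input d b X" "finite W" "gates_ok (reg d b W) gs" "supported (reg d b W) v"
    and c: "\<And>k. ip (reg d b W) v ((run (reg d b W) X gs ^^ k) v) = of_real (cos (real k * \<theta>))"
  shows "ip (reg d b W) ((run (reg d b W) X gs ^^ x) v) ((run (reg d b W) X gs ^^ y) v) =
    of_real (cos ((real x - real y) * \<theta>))"
proof -
  let ?B = "reg d b W" and ?R = "run (reg d b W) X gs"
  have sup: "supported ?B ((?R ^^ k) v)" for k
    by (induction k) (simp_all add: assms(4) supported_run)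
  obtain U where U: "uni ?B U" "\<And>\<psi>. supported ?B \<psi> \<Longrightarrow> ?R \<psi> = app ?B U \<psi>"
    using run_eq_app[OF assms(1-3)] by blast
  have step: "ip ?B ((?R ^^ Suc k) v) ((?R ^^ Suc l) v) = ip ?B ((?R ^^ k) v) ((?R ^^ l) v)" for k l
    using assms(2) U sup by (simp add: ip_app)
  have diff: "ip ?B ((?R ^^ k) v) ((?R ^^ (k + l)) v) = of_real (cos (real l * \<theta>))" for k l
    by (induction k) (simp_all only: step add_Suc funpow_0 add_0 c)
  show ?thesis
  proof (cases "x \<le> y")
    case True
    have "(real x - real y) * \<theta> = - (real (y - x) * \<theta>)" using True by (simp add: algebra_simps)
    thus ?thesis using diff[of x "y - x"] True by simp
  next
    case False
    have "(real x - real y) * \<theta> = real (x - y) * \<theta>" using False by (simp add: of_nat_diff)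
    moreover have "ip ?B ((?R ^^ x) v) ((?R ^^ y) v) = cnj (of_real (cos (real (x - y) * \<theta>)))"
      using diff[of y "x - y"] False ip_cnj[of ?B "(?R ^^ y) v" "(?R ^^ x) v"]
      by (simp del: complex_cnj_complex_of_real)
    ultimately show ?thesis by (simp only: complex_cnj_complex_of_real)
  qed
qed

text \<open>The control values stop at N - 1, hence N - 1 controlled walk steps. After them slice x
  holds a x times the x-th walk vector, and the Fourier transform of the control register gives sums
  of the shape treated in \<open>sum_norm_equiangular\<close>. Since f and S are quantified after
  the circuit, one algorithm serves every later choice of estimator.\<close>

lemma phase_estimation:
  fixes gs :: "'w gate list" and v :: "nat \<times> nat \<times> 'w \<Rightarrow> complex" and a :: "nat \<Rightarrow> complex"
  assumes W: "finite W" "w0 \<in> W" and "0 < d" and N: "0 < N"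
    and gs: "gates_ok (reg d b W) gs" "even (queries gs)"
    and v: "supported (reg d b W) v" "ip (reg d b W) v v = 1" "Im (v (0, 0, w0)) = 0"
    and a: "(\<Sum>x<N. (cmod (a x))\<^sup>2) = 1" "Im (a 0) = 0"
    and walk: "\<forall>X k. valid_input d b X \<longrightarrow>
      ip (reg d b W) v ((run (reg d b W) X gs ^^ k) v) = of_real (cos (real k * \<theta> X))"
  shows "\<exists>M U Us out. is_query_alg d b M U Us \<and> length Us = (N - 1) * queries gs \<and>
    (\<forall>X f S. valid_input d b X \<longrightarrow> out_prob d b M U Us (\<lambda>i. f (out i :: nat)) X S =
       (\<Sum>y\<in>{y. y < N \<and> f y \<in> S}. (spec N a (\<theta> X) y + spec N a (- \<theta> X) y) / 2))"
proof -
  let ?B = "reg d b W" and ?B' = "reg d b ({..<N} \<times> W)"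
  let ?init = "\<lambda>i. if i = (0, 0, 0, w0) then 1 else (0::complex)"
  have W': "finite ({..<N} \<times> W)" "(0, w0) \<in> {..<N} \<times> W" using W N by auto
  define \<Psi> where "\<Psi> = (\<lambda>(j::nat, z::nat, x, w). if x < N then a x * v (j, z, w) else 0)"
  have sl: "slice x \<Psi> = (\<lambda>i. a x * v i)" if "x < N" for x
    using that by (auto simp: slice_def \<Psi>_def)
  have sup\<Psi>: "supported ?B' \<Psi>" using v(1) by (auto simp: supported_def \<Psi>_def reg_def)
  have "ip ?B' \<Psi> \<Psi> = (\<Sum>x<N. \<Sum>r\<in>?B. cnj (slice x \<Psi> r) * slice x \<Psi> r)"
    unfolding ip_def sum_controlled_reg by (intro sum.cong HOL.refl) (auto simp: slice_def)
  also have "\<dots> = (\<Sum>x<N. cnj (a x) * a x * ip ?B v v)"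
    by (intro sum.cong HOL.refl) (simp add: sl ip_def sum_distrib_left mult_ac)
  also have "\<dots> = of_real (\<Sum>x<N. (cmod (a x))\<^sup>2)"
    unfolding v(2) of_real_sum by (simp add: complex_norm_square[symmetric] mult.commute)
  finally have ip\<Psi>: "ip ?B' \<Psi> \<Psi> = 1" by (simp only: a(1) of_real_1)
  have "(0, 0, 0, w0) \<in> ?B'" using W assms(3) N by (auto simp: reg_def)
  \<comment> \<open>A single unitary prepares the product state. Its entry at the start vector is a
    0 * v (0, 0, w0), and both factors are real, as the Householder construction requires.\<close>
  then obtain U where U: "uni ?B' U" "app ?B' U ?init = \<Psi>"
    using ex_uni_first_column[of ?B' "(0, 0, 0, w0)" \<Psi>] W' sup\<Psi> ip\<Psi> v(3) a(2) N
    by (auto simp: \<Psi>_def)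
  define hs where "hs = Gate U # ctrl_powers (N - 1) gs @ [Gate (tensor_fst (fourier N))]"
  have hs: "gates_ok ?B' hs" "queries hs = (N - 1) * queries gs"
    using gates_ok_ctrl_powers[OF W(1) gs(1)] U(1) uni_tensor_fst[OF W(1) uni_fourier[OF N]]
    by (simp_all add: hs_def queries_ctrl_powers)
  have fin: "(\<Sum>r\<in>?B. (cmod (slice y (run ?B' X hs ?init) r))\<^sup>2) =
      (spec N a (\<theta> X) y + spec N a (- \<theta> X) y) / 2"
    if X: "valid_input d b X" and y: "y < N" for X y
  proof -
    let ?u = "\<lambda>x. (run ?B X gs ^^ x) v"
    have "slice y (run ?B' X hs ?init) r = (\<Sum>x<N. fourier N y x * a x * ?u x r)" if "r \<in> ?B" for r
    proof -
      have "slice x (run ?B' X (ctrl_powers (N - 1) gs) \<Psi>) r = a x * ?u x r" if "x < N" for x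
        using slice_run_ctrl_powers[OF X W(1) that gs(2) sup\<Psi>, of "N - 1"] that
        by (simp add: sl run_funpow_scale min_absorb2)
      thus ?thesis using that
        by (simp add: hs_def U(2) app_tensor_fst[OF W(1) y] mult.assoc)
    qed
    hence "(\<Sum>r\<in>?B. (cmod (slice y (run ?B' X hs ?init) r))\<^sup>2) =
       (\<Sum>r\<in>?B. (cmod (\<Sum>x<N. (fourier N y x * a x) * ?u x r))\<^sup>2)"
      by simp
    also have "\<dots> = (spec N a (\<theta> X) y + spec N a (- \<theta> X) y) / 2"
      using sum_norm_equiangular[of N ?B ?u "\<theta> X" "\<lambda>x. fourier N y x * a x"]
        run_funpow_ip[OF X W(1) gs(1) v(1) walk[rule_format, OF X]]
      by (simp add: spec_def)
    finally show ?thesis .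
  qed
  have "(\<Sum>i\<in>{i\<in>?B'. f (case i of (j, z, x, w) \<Rightarrow> x) \<in> S}. (cmod (run ?B' X hs ?init i))\<^sup>2) =
      (\<Sum>y\<in>{y. y < N \<and> f y \<in> S}. (spec N a (\<theta> X) y + spec N a (- \<theta> X) y) / 2)"
    if X: "valid_input d b X" for X and f :: "nat \<Rightarrow> real" and S
  proof -
    have "(\<Sum>i\<in>{i\<in>?B'. f (case i of (j, z, x, w) \<Rightarrow> x) \<in> S}. (cmod (run ?B' X hs ?init i))\<^sup>2)
       = (\<Sum>i\<in>?B'. if f (case i of (j, z, x, w) \<Rightarrow> x) \<in> S then (cmod (run ?B' X hs ?init i))\<^sup>2 else 0)"
      using W' by (intro sum.inter_filter) simp
    also have "\<dots> = (\<Sum>y<N. if f y \<in> S then (\<Sum>r\<in>?B. (cmod (slice y (run ?B' X hs ?init) r))\<^sup>2) else 0)"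
      unfolding sum_controlled_reg by (intro sum.cong HOL.refl) (auto simp: slice_def intro!: sum.cong sum.neutral)
    also have "\<dots> = (\<Sum>y<N. if f y \<in> S then (spec N a (\<theta> X) y + spec N a (- \<theta> X) y) / 2 else 0)"
      by (intro sum.cong HOL.refl) (simp add: fin[OF X])
    also have "\<dots> = (\<Sum>y\<in>{y\<in>{..<N}. f y \<in> S}. (spec N a (\<theta> X) y + spec N a (- \<theta> X) y) / 2)"
      by (rule sum.inter_filter[symmetric]) simp
    finally show ?thesis by simp
  qed
  thus ?thesis
    using query_alg_of_run[OF W' assms(3) hs(1), of "\<lambda>(j, z, x, w). x"] hs(2) by simp
qed

section \<open>Reversible circuits and the walk operator\<close>

lemma app_perm_involution:
  assumes "finite B" "\<And>i. i \<in> B \<Longrightarrow> \<pi> i \<in> B" "\<And>i. i \<in> B \<Longrightarrow> \<pi> (\<pi> i) = i" "supported B \<psi>"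
  shows "app B (perm \<pi>) (app B (perm \<pi>) \<psi>) = \<psi>"
proof -
  have "app B (perm \<pi>) \<phi> = (\<lambda>i. if i \<in> B then \<phi> (\<pi> i) else 0)" for \<phi>
    using assms(1,2) by (rule app_perm)
  thus ?thesis using assms(2-4) by (auto simp: supported_def fun_eq_iff)
qed

text \<open>Lets a uniform superposition be traced through a permutation circuit by following the
  labels g k one at a time.\<close>

lemma app_perm_indicator:
  assumes "finite B" "\<And>i. i \<in> B \<Longrightarrow> \<pi> i \<in> B" "\<And>i. i \<in> B \<Longrightarrow> \<pi> (\<pi> i) = i"
    and "\<And>k. k \<in> I \<Longrightarrow> g k \<in> B"
  shows "app B (perm \<pi>) (\<lambda>i. if i \<in> g ` I then c else 0) = (\<lambda>i. if i \<in> (\<lambda>k. \<pi> (g k)) ` I then c else 0)"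
proof -
  have "(i \<in> B \<and> \<pi> i \<in> g ` I) \<longleftrightarrow> i \<in> (\<lambda>k. \<pi> (g k)) ` I" for i
  proof
    assume i: "i \<in> B \<and> \<pi> i \<in> g ` I"
    then obtain k where "k \<in> I" "\<pi> i = g k" by blast
    moreover have "i = \<pi> (\<pi> i)" using assms(3) i by simp
    ultimately show "i \<in> (\<lambda>k. \<pi> (g k)) ` I" by auto
  next
    assume "i \<in> (\<lambda>k. \<pi> (g k)) ` I"
    then obtain k where "k \<in> I" "i = \<pi> (g k)" by blast
    thus "i \<in> B \<and> \<pi> i \<in> g ` I" using assms(2-4) by simp
  qed
  moreover have "app B (perm \<pi>) \<phi> = (\<lambda>i. if i \<in> B then \<phi> (\<pi> i) else 0)" for \<phi>
    using assms(1,2) by (rule app_perm)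
  ultimately show ?thesis by (auto simp: fun_eq_iff)
qed

text \<open>Gates that are involutions make the reversed list the inverse circuit, at the same query
  cost.\<close>

lemma run_rev:
  assumes "\<And>g \<psi>. g \<in> set gs \<Longrightarrow> supported B \<psi> \<Longrightarrow> app B (gate_mat X g) (app B (gate_mat X g) \<psi>) = \<psi>"
    and "supported B \<psi>"
  shows "run B X (rev gs) (run B X gs \<psi>) = \<psi>"
  using assms
proof (induction gs arbitrary: \<psi>)
  case (Cons g gs)
  have "run B X (rev gs) (run B X gs (app B (gate_mat X g) \<psi>)) = app B (gate_mat X g) \<psi>"
    by (rule Cons.IH) (use Cons.prems(1) in auto)
  thus ?case using Cons.prems(1)[of g \<psi>] Cons.prems(2) by simp
qed simp

text \<open>The walk operator is the product of the reflection \<open>S = E\<^sup>-\<^sup>1 (1 - 2P) E\<close> and the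
  reflection at the hyperplane orthogonal to \<open>v\<close>. It acts as a rotation on the span of
  \<open>v\<close> and \<open>S v\<close>; the recurrence for its powers needs no basis of this (possibly
  one-dimensional) space.\<close>

lemma run_walk:
  fixes E :: "'w gate list"
  assumes X: "valid_input d b X" and W: "finite W" and E: "gates_ok (reg d b W) E"
    and inv: "\<And>g \<psi>. g \<in> set E \<Longrightarrow> supported (reg d b W) \<psi> \<Longrightarrow>
      app (reg d b W) (gate_mat X g) (app (reg d b W) (gate_mat X g) \<psi>) = \<psi>"
    and P: "\<And>i j. i \<in> reg d b W \<Longrightarrow> j \<in> reg d b W \<Longrightarrow> cnj (P j i) = P i j"
      "\<And>i j. i \<in> reg d b W \<Longrightarrow> j \<in> reg d b W \<Longrightarrow> (\<Sum>k\<in>reg d b W. P i k * P k j) = P i j"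
    and v: "supported (reg d b W) v" "ip (reg d b W) v v = 1"
    and \<theta>: "ip (reg d b W) (run (reg d b W) X E v) (app (reg d b W) (refl_mat P) (run (reg d b W) X E v))
      = of_real (- cos \<theta>)"
    and gs: "gs = E @ Gate (refl_mat P) # rev E @ [Gate (refl_mat (proj_mat v))]"
  shows "ip (reg d b W) v ((run (reg d b W) X gs ^^ k) v) = of_real (cos (real k * \<theta>))"
proof -
  let ?B = "reg d b W"
  define S where "S = (\<lambda>\<psi>. run ?B X (rev E) (app ?B (refl_mat P) (run ?B X E \<psi>)))"
  have fB: "finite ?B" using W by simp
  have supS: "supported ?B (S \<psi>)" for \<psi> by (simp add: S_def supported_run)
  have run_gs: "run ?B X gs \<psi> = app ?B (refl_mat (proj_mat v)) (S \<psi>)" for \<psi>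
    by (simp add: gs S_def)
  have gs_ok: "gates_ok ?B gs"
    unfolding gs using E uni_refl_mat[OF fB P] uni_refl_proj[OF fB v(2)] by simp
  obtain U where U: "\<And>\<psi>. supported ?B \<psi> \<Longrightarrow> run ?B X gs \<psi> = app ?B U \<psi>"
    using run_eq_app[OF X W gs_ok] by blast
  obtain V where V: "uni ?B V" "\<And>\<psi>. supported ?B \<psi> \<Longrightarrow> run ?B X E \<psi> = app ?B V \<psi>"
    using run_eq_app[OF X W E] by blast
  have E_rev: "run ?B X E (run ?B X (rev E) \<psi>) = \<psi>" if "supported ?B \<psi>" for \<psi>
    using run_rev[of "rev E" ?B, OF _ that] inv by (simp only: rev_rev_ident set_rev)
  have SS: "S (S v) = v"
  proof -
    have "app ?B (refl_mat P) (app ?B (refl_mat P) (run ?B X E v)) = run ?B X E v"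
      by (rule app_refl_mat_involution[OF fB supported_run[OF v(1)] P(2)])
    thus ?thesis
      unfolding S_def E_rev[OF supported_app] using run_rev[OF inv v(1)] by (simp only:)
  qed
  \<comment> \<open>E preserves inner products, so the matrix element of S at v is that of 1 - 2P at
    E v.\<close>
  have "ip ?B v (S v) = ip ?B (run ?B X E v) (run ?B X E (S v))"
    by (simp only: ip_app[OF fB V(1)] V(2)[OF v(1)] V(2)[OF supS])
  also have "\<dots> = of_real (- cos \<theta>)"
    by (simp only: S_def E_rev[OF supported_app] \<theta>)
  finally have vS: "ip ?B v (S v) = of_real (- cos \<theta>)" .
  have R: "run ?B X gs \<psi> = (\<lambda>i. S \<psi> i - 2 * ip ?B v (S \<psi>) * v i)" for \<psi>
    unfolding run_gs by (rule app_refl_proj[OF fB supS v(1)])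
  have Uv: "app ?B U v = (\<lambda>i. 1 * S v i + of_real (2 * cos \<theta>) * v i)"
    using R[of v] U[OF v(1)] vS by (simp add: fun_eq_iff)
  \<comment> \<open>S (S v) = v, and the reflection sends the unit vector v to -v.\<close>
  have USv: "app ?B U (S v) = (\<lambda>i. - v i)"
    using R[of "S v"] U[OF supS] SS v(2) by (simp add: fun_eq_iff)
  have "app ?B U (app ?B U v) = (\<lambda>i. 1 * app ?B U (S v) i + of_real (2 * cos \<theta>) * app ?B U v i)"
    by (subst Uv) (rule app_lin)
  hence rec: "app ?B U (app ?B U v) = (\<lambda>i. of_real (2 * cos \<theta>) * app ?B U v i + (-1) * v i)"
    by (simp add: USv fun_eq_iff)
  have "ip ?B v (app ?B U v) = 1 * ip ?B v (S v) + of_real (2 * cos \<theta>) * ip ?B v v"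
    unfolding Uv by (rule ip_lin_right)
  hence c: "ip ?B v (app ?B U v) = of_real (cos \<theta>)"
    by (simp add: vS v(2))
  have sup: "supported ?B ((run ?B X gs ^^ k) v)" for k
    by (induction k) (simp_all add: v(1) supported_run)
  have "(run ?B X gs ^^ k) v = (app ?B U ^^ k) v"
  proof (induction k)
    case (Suc k)
    thus ?case using U[OF sup, of k] by simp
  qed simp
  thus ?thesis using walk_cos[OF fB v(2) c rec, of k] by simp
qed

section \<open>Coherent evaluation of decision trees\<close>

text \<open>A leaf is its own child, so every tree can be followed for exactly h levels and one
  circuit fits all branches of the superposition.\<close>

fun child :: "dtree \<Rightarrow> bool \<Rightarrow> dtree" where
  "child (Leaf y) u = Leaf y"
| "child (Node j c l r) u = (if u then l else r)"

text \<open>At a leaf the circuit still queries; attribute 0 is a legal dummy index because d > 0,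
  and \<open>test\<close> ignores the answer there.\<close>

fun attr :: "dtree \<Rightarrow> nat" where
  "attr (Leaf y) = 0"
| "attr (Node j c l r) = j"

fun test :: "dtree \<Rightarrow> nat \<Rightarrow> bool" where
  "test (Leaf y) z = False"
| "test (Node j c l r) z = c z"

fun label :: "dtree \<Rightarrow> real" where
  "label (Leaf y) = y"
| "label (Node j c l r) = 0"

text \<open>A path is encoded by the set of levels at which the left child is taken.\<close>

fun descend :: "dtree \<Rightarrow> nat set \<Rightarrow> nat \<Rightarrow> dtree" where
  "descend T p 0 = T"
| "descend T p (Suc s) = child (descend T p s) (s \<in> p)"

fun path :: "dtree \<Rightarrow> (nat \<Rightarrow> nat) \<Rightarrow> nat \<Rightarrow> nat set" where
  "path T X 0 = {}"
| "path T X (Suc s) = (let T' = descend T (path T X s) s in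
     if test T' (X (attr T')) then insert s (path T X s) else path T X s)"

text \<open>The node at level s is determined by the decisions below s. This is why recording the
  decision at level s neither changes the node it came from nor spoils the reversibility of
  \<open>branch\<close>.\<close>

lemma descend_cong: "(\<And>k. k < s \<Longrightarrow> k \<in> p \<longleftrightarrow> k \<in> q) \<Longrightarrow> descend T p s = descend T q s"
  by (induction s) auto

lemma path_less: "k \<in> path T X s \<Longrightarrow> k < s"
  by (induction s) (auto simp: Let_def less_Suc_eq split: if_splits)

lemma eval_descend_path: "eval_tree (descend T (path T X s) s) X = eval_tree T X"
proof (induction s)
  case (Suc s)
  have *: "descend T (path T X (Suc s)) s = descend T (path T X s) s"
    by (rule descend_cong) (auto simp: Let_def)
  have "s \<notin> path T X s" using path_less by blast
  thus ?case using Suc * by (cases "descend T (path T X s) s") (auto simp: Let_def)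
qed simp

lemma height_descend: "height (descend T p s) \<le> height T - s"
proof (induction s)
  case (Suc s)
  thus ?case by (cases "descend T p s") auto
qed simp

lemma label_descend_path:
  assumes "height T \<le> h"
  shows "label (descend T (path T X h) h) = eval_tree T X"
proof -
  have "height (descend T (path T X h) h) = 0"
    using height_descend[of T "path T X h" h] assms by simp
  then obtain y where "descend T (path T X h) h = Leaf y"
    by (cases "descend T (path T X h) h") auto
  thus ?thesis using eval_descend_path[of T X h] by simp
qed

lemma attr_descend:
  assumes "attrs_ok d T" "0 < d"
  shows "attr (descend T p s) < d"
proof -
  have "attrs_ok d (descend T p s)"
  proof (induction s)
    case (Suc s)
    thus ?case by (cases "descend T p s") auto
  qed (simp add: assms)
  thus ?thesis using assms(2) by (cases "descend T p s") auto
qed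

text \<open>The components are the tree index, the qubit that will carry the tree value, and the
  recorded path.\<close>

type_synonym cell = "nat \<times> bool \<times> nat set"

definition cells :: "nat \<Rightarrow> nat \<Rightarrow> cell set" where
  "cells n h = {..<n} \<times> UNIV \<times> Pow {..<h}"

text \<open>Index 0 is exchanged with the wanted attribute instead of being overwritten, which makes
  the map an involution.\<close>

definition point :: "dtree list \<Rightarrow> nat \<Rightarrow> nat \<times> nat \<times> cell \<Rightarrow> nat \<times> nat \<times> cell" where
  "point F s = (\<lambda>(j, z, i, q, p). (Transposition.transpose 0 (attr (descend (F ! i) p s)) j, z, i, q, p))"

text \<open>The membership of s is toggled, the reversible form of writing a bit into an empty
  position.\<close>

definition branch :: "dtree list \<Rightarrow> nat \<Rightarrow> nat \<times> nat \<times> cell \<Rightarrow> nat \<times> nat \<times> cell" where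
  "branch F s = (\<lambda>(j, z, i, q, p). (j, z, i, q,
     if test (descend (F ! i) p s) z then (if s \<in> p then p - {s} else insert s p) else p))"

text \<open>A palindrome: after the branch bit is recorded, the second half undoes the query and the
  index change. It can, since the node at level s is still readable from the path.\<close>

definition step_gates :: "dtree list \<Rightarrow> nat \<Rightarrow> cell gate list" where
  "step_gates F s = [Gate (perm (point F s)), Query, Gate (perm (branch F s)), Query, Gate (perm (point F s))]"

definition eval_gates :: "dtree list \<Rightarrow> nat \<Rightarrow> cell gate list" where
  "eval_gates F m = concat (map (step_gates F) [0..<m])"

lemma eval_gates_Suc: "eval_gates F (Suc m) = eval_gates F m @ step_gates F m"
  by (simp add: eval_gates_def)

lemma queries_eval_gates: "queries (eval_gates F m) = 2 * m"
  by (induction m) (simp_all add: eval_gates_Suc step_gates_def, simp add: eval_gates_def)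

lemma finite_cells [simp]: "finite (cells n h)"
  by (simp add: cells_def)

lemma point_reg:
  assumes "0 < d" "\<And>T. T \<in> set F \<Longrightarrow> attrs_ok d T" "i \<in> reg d b (cells (length F) h)"
  shows "point F s i \<in> reg d b (cells (length F) h)" "point F s (point F s i) = i"
  using assms attr_descend
  by (auto simp: point_def reg_def cells_def Transposition.transpose_def)

lemma branch_reg:
  assumes "s < h" "i \<in> reg d b (cells n h)"
  shows "branch F s i \<in> reg d b (cells n h)" "branch F s (branch F s i) = i"
proof -
  have *: "descend T (p - {s}) s = descend T p s" "descend T (insert s p) s = descend T p s" for T p
    by (rule descend_cong; auto)+
  show "branch F s i \<in> reg d b (cells n h)"
    using assms by (auto simp: branch_def reg_def cells_def split: if_splits)
  show "branch F s (branch F s i) = i"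
    by (cases i) (auto simp: branch_def *)
qed

lemma step_gates_involution:
  assumes "0 < d" "\<And>T. T \<in> set F \<Longrightarrow> attrs_ok d T" "s < h" "valid_input d b X"
    and "g \<in> set (step_gates F s)" "supported (reg d b (cells (length F) h)) \<psi>"
  shows "app (reg d b (cells (length F) h)) (gate_mat X g)
    (app (reg d b (cells (length F) h)) (gate_mat X g) \<psi>) = \<psi>"
  using assms(5)
proof -
  consider "g = Gate (perm (point F s))" | "g = Query" | "g = Gate (perm (branch F s))"
    using assms(5) by (auto simp: step_gates_def)
  thus ?thesis
    using assms point_reg[OF assms(1,2)] branch_reg[OF assms(3)] ask_reg[OF assms(4), of _ "cells (length F) h"]
    by cases (simp_all add: app_perm_involution)
qed

lemma gates_ok_step_gates:
  assumes "0 < d" "\<And>T. T \<in> set F \<Longrightarrow> attrs_ok d T" "s < h"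
  shows "gates_ok (reg d b (cells (length F) h)) (step_gates F s)"
  using point_reg[OF assms(1,2)] branch_reg[OF assms(3)]
  by (simp add: step_gates_def uni_perm bij_betw_involution)

lemma eval_gates_involution:
  assumes "0 < d" "\<And>T. T \<in> set F \<Longrightarrow> attrs_ok d T" "valid_input d b X"
    and "g \<in> set (eval_gates F h)" "supported (reg d b (cells (length F) h)) \<psi>"
  shows "app (reg d b (cells (length F) h)) (gate_mat X g)
    (app (reg d b (cells (length F) h)) (gate_mat X g) \<psi>) = \<psi>"
proof -
  obtain s where "s < h" "g \<in> set (step_gates F s)"
    using assms(4) by (auto simp: eval_gates_def)
  thus ?thesis using step_gates_involution[OF assms(1,2) _ assms(3) _ assms(5)] by blast
qed

lemma gates_ok_eval_gates:
  assumes "0 < d" "\<And>T. T \<in> set F \<Longrightarrow> attrs_ok d T" "m \<le> h"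
  shows "gates_ok (reg d b (cells (length F) h)) (eval_gates F m)"
  using assms(3)
proof (induction m)
  case (Suc m)
  thus ?case using gates_ok_step_gates[OF assms(1,2), of F m h b] by (simp add: eval_gates_Suc)
qed (simp add: eval_gates_def)

text \<open>Registers j and z are back at 0 after every level, so the state stays a uniform
  superposition over the trees, each carrying its own path.\<close>

lemma run_eval_gates:
  assumes d: "0 < d" and F: "\<And>T. T \<in> set F \<Longrightarrow> attrs_ok d T" and X: "valid_input d b X" and "m \<le> h"
  shows "run (reg d b (cells (length F) h)) X (eval_gates F m)
     (\<lambda>a. if a \<in> (\<lambda>i. (0, 0, i, False, {})) ` {..<length F} then c else 0) =
     (\<lambda>a. if a \<in> (\<lambda>i. (0, 0, i, False, path (F ! i) X m)) ` {..<length F} then c else 0)"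
  using assms(4)
proof (induction m)
  case 0
  show ?case by (simp add: eval_gates_def)
next
  case (Suc m)
  let ?B = "reg d b (cells (length F) h)"
  let ?a = "\<lambda>i. attr (descend (F ! i) (path (F ! i) X m) m)"
  have fB: "finite ?B" by simp
  note ind = app_perm_indicator[OF fB]
  have m: "m < h" using Suc by simp
  have sub: "path (F ! i) X k \<subseteq> {..<h}" if "k \<le> h" for i k
    using path_less[of _ "F ! i" X k] that by fastforce
  have a: "?a i < d" if "i < length F" for i
    using that F attr_descend d by simp
  have Xa: "X (?a i) < 2 ^ b" if "i < length F" for i
    using a[OF that] X by (simp add: valid_input_def)
  have 1: "app ?B (perm (point F m)) (\<lambda>a. if a \<in> (\<lambda>i. (0, 0, i, False, path (F ! i) X m)) ` {..<length F} then c else 0)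
     = (\<lambda>a. if a \<in> (\<lambda>i. (?a i, 0, i, False, path (F ! i) X m)) ` {..<length F} then c else 0)"
    using d sub[of m] m
    by (subst ind[OF point_reg[OF d F]]) (auto simp: point_def reg_def cells_def)
  have 2: "app ?B (perm (ask X)) (\<lambda>a. if a \<in> (\<lambda>i. (?a i, 0, i, False, path (F ! i) X m)) ` {..<length F} then c else 0)
     = (\<lambda>a. if a \<in> (\<lambda>i. (?a i, X (?a i), i, False, path (F ! i) X m)) ` {..<length F} then c else 0)"
    using a sub[of m] m
    by (subst ind[OF ask_reg[OF X] ask_involution]) (auto simp: ask_def reg_def cells_def)
  have br: "branch F m (?a i, X (?a i), i, False, path (F ! i) X m) =
      (?a i, X (?a i), i, False, path (F ! i) X (Suc m))" for i
    using path_less[of m "F ! i" X m] by (auto simp: branch_def Let_def)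
  have 3: "app ?B (perm (branch F m)) (\<lambda>a. if a \<in> (\<lambda>i. (?a i, X (?a i), i, False, path (F ! i) X m)) ` {..<length F} then c else 0)
     = (\<lambda>a. if a \<in> (\<lambda>i. (?a i, X (?a i), i, False, path (F ! i) X (Suc m))) ` {..<length F} then c else 0)"
    using a Xa sub[of m] m
    by (subst ind[OF branch_reg[OF m]]) (auto simp: reg_def cells_def br simp del: path.simps)
  have 4: "app ?B (perm (ask X)) (\<lambda>a. if a \<in> (\<lambda>i. (?a i, X (?a i), i, False, path (F ! i) X (Suc m))) ` {..<length F} then c else 0)
     = (\<lambda>a. if a \<in> (\<lambda>i. (?a i, 0, i, False, path (F ! i) X (Suc m))) ` {..<length F} then c else 0)"
    using a Xa sub[of "Suc m"] Suc.prems
    by (subst ind[OF ask_reg[OF X] ask_involution]) (auto simp: ask_def reg_def cells_def simp del: path.simps)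
  \<comment> \<open>Recording level m leaves the node at level m fixed, so the second
    \<open>point\<close> swaps the same attribute back to 0.\<close>
  have "descend (F ! i) (path (F ! i) X (Suc m)) m = descend (F ! i) (path (F ! i) X m) m" for i
    by (rule descend_cong) (auto simp: Let_def)
  hence pt: "point F m (?a i, 0, i, False, path (F ! i) X (Suc m)) =
      (0, 0, i, False, path (F ! i) X (Suc m))" for i
    by (simp add: point_def del: path.simps)
  have 5: "app ?B (perm (point F m)) (\<lambda>a. if a \<in> (\<lambda>i. (?a i, 0, i, False, path (F ! i) X (Suc m))) ` {..<length F} then c else 0)
     = (\<lambda>a. if a \<in> (\<lambda>i. (0, 0, i, False, path (F ! i) X (Suc m))) ` {..<length F} then c else 0)"
    using a sub[of "Suc m"] Suc.prems
    by (subst ind[OF point_reg[OF d F]]) (auto simp: pt reg_def cells_def simp del: path.simps)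
  show ?case
    using Suc.IH Suc.prems
    by (simp add: eval_gates_Suc step_gates_def 1 2 3 4 5 del: path.simps)
qed

text \<open>The qubit \<open>q\<close> turns the value \<open>g\<close> attached to a path into a reflection whose
  matrix element at \<open>q = 0\<close> is \<open>1 - 2 g\<close>.\<close>

definition value_proj :: "(nat \<Rightarrow> nat set \<Rightarrow> real) \<Rightarrow> nat \<times> nat \<times> cell \<Rightarrow> nat \<times> nat \<times> cell \<Rightarrow> complex" where
  "value_proj g = (\<lambda>(j, z, i, q, p) (j', z', i', q', p').
     if (j, z, i, p) = (j', z', i', p') then
       of_real (sqrt (if q then 1 - g i p else g i p) * sqrt (if q' then 1 - g i p else g i p))
     else 0)"

lemma value_proj_hermitian: "cnj (value_proj g a' a) = value_proj g a a'"
  by (cases a; cases a') (auto simp: value_proj_def)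

text \<open>For fixed (j, z, i, p) the two-dimensional block on q is the rank-one projection onto
  (sqrt g, sqrt(1 - g)), a unit vector since 0 \<le> g \<le> 1. Only the two values of q contribute
  to the sum.\<close>

lemma value_proj_idem:
  assumes "\<And>i p. 0 \<le> g i p \<and> g i p \<le> 1" "a \<in> reg d b (cells n h)"
  shows "(\<Sum>k\<in>reg d b (cells n h). value_proj g a k * value_proj g k a') = value_proj g a a'"
proof -
  obtain j z i q p where a: "a = (j, z, i, q, p)" by (metis prod_cases5)
  obtain j' z' i' q' p' where a': "a' = (j', z', i', q', p')" by (metis prod_cases5)
  let ?K = "{(j, z, i, False, p), (j, z, i, True, p)}"
  have g: "sqrt (g i p) * sqrt (g i p) = g i p" "sqrt (1 - g i p) * sqrt (1 - g i p) = 1 - g i p"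
    using assms(1)[of i p] by (simp_all only: real_sqrt_mult_self abs_of_nonneg diff_ge_0_iff_ge)
  have "(\<Sum>k\<in>reg d b (cells n h). value_proj g a k * value_proj g k a') =
      (\<Sum>k\<in>?K. value_proj g a k * value_proj g k a')"
  proof (rule sum.mono_neutral_right)
    show "?K \<subseteq> reg d b (cells n h)"
      using assms(2) by (auto simp: a reg_def cells_def)
    show "\<forall>k\<in>reg d b (cells n h) - ?K. value_proj g a k * value_proj g k a' = 0"
    proof
      fix k assume k: "k \<in> reg d b (cells n h) - ?K"
      obtain j1 z1 i1 q1 p1 where k1: "k = (j1, z1, i1, q1, p1)" by (metis prod_cases5)
      have "(j, z, i, p) \<noteq> (j1, z1, i1, p1)" using k unfolding k1 by (cases q1) auto
      thus "value_proj g a k * value_proj g k a' = 0" by (auto simp: a k1 value_proj_def)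
    qed
  qed simp
  also have "\<dots> = value_proj g a (j, z, i, False, p) * value_proj g (j, z, i, False, p) a' +
      value_proj g a (j, z, i, True, p) * value_proj g (j, z, i, True, p) a'"
    by simp
  also have "\<dots> = value_proj g a a'"
  proof (cases "(j, z, i, p) = (j', z', i', p')")
    case True
    define t t' where "t = sqrt (if q then 1 - g i p else g i p)"
      and "t' = sqrt (if q' then 1 - g i p else g i p)"
    have "value_proj g a (j, z, i, False, p) = of_real (t * sqrt (g i p))"
      "value_proj g (j, z, i, False, p) a' = of_real (sqrt (g i p) * t')"
      "value_proj g a (j, z, i, True, p) = of_real (t * sqrt (1 - g i p))"
      "value_proj g (j, z, i, True, p) a' = of_real (sqrt (1 - g i p) * t')"
      "value_proj g a a' = of_real (t * t')"
      using True by (simp_all add: value_proj_def a a' t_def t'_def)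
    moreover have "t * sqrt (g i p) * (sqrt (g i p) * t') + t * sqrt (1 - g i p) * (sqrt (1 - g i p) * t')
        = t * t' * (sqrt (g i p) * sqrt (g i p) + sqrt (1 - g i p) * sqrt (1 - g i p))"
      by (simp only: distrib_left mult_ac)
    hence "t * sqrt (g i p) * (sqrt (g i p) * t') + t * sqrt (1 - g i p) * (sqrt (1 - g i p) * t') = t * t'"
      unfolding g by simp
    ultimately show ?thesis by (simp only: of_real_mult[symmetric] of_real_add[symmetric])
  next
    case False
    hence "value_proj g a (j, z, i, False, p) * value_proj g (j, z, i, False, p) a' = 0"
      "value_proj g a (j, z, i, True, p) * value_proj g (j, z, i, True, p) a' = 0" "value_proj g a a' = 0"
      by (auto simp: value_proj_def a a')
    thus ?thesis by (simp only: add_0)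
  qed
  finally show ?thesis .
qed

text \<open>Different trees sit in different blocks of the projection, so cross terms vanish and the
  n diagonal elements 1 - 2 g are averaged.\<close>

lemma ip_indicator_value_refl:
  assumes "n > 0" "\<And>i. i < n \<Longrightarrow> (0, 0, i, False, P i) \<in> reg d b (cells n h)"
    and g: "\<And>i p. 0 \<le> g i p \<and> g i p \<le> 1"
    and \<phi>: "\<phi> = (\<lambda>a. if a \<in> (\<lambda>i. (0, 0, i, False, P i)) ` {..<n} then complex_of_real (1 / sqrt (real n)) else 0)"
  shows "ip (reg d b (cells n h)) \<phi> (app (reg d b (cells n h)) (refl_mat (value_proj g)) \<phi>) =
    of_real (1 - 2 * ((1 / real n) * (\<Sum>i<n. g i (P i))))"
proof -
  let ?B = "reg d b (cells n h)" and ?e = "\<lambda>i. (0::nat, 0::nat, i, False, P i)"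
  let ?c = "complex_of_real (1 / sqrt (real n))"
  have inj: "inj_on ?e {..<n}" by (auto simp: inj_on_def)
  have sub: "?e ` {..<n} \<subseteq> ?B" using assms(2) by auto
  have cc: "?c * ?c = of_real (1 / real n)"
    unfolding of_real_mult[symmetric] by simp
  have sumB: "(\<Sum>a\<in>?B. f a * (if a \<in> ?e ` {..<n} then ?c else 0)) = (\<Sum>i<n. f (?e i) * ?c)" for f
  proof -
    have "(\<Sum>a\<in>?B. f a * (if a \<in> ?e ` {..<n} then ?c else 0)) = (\<Sum>a\<in>?e ` {..<n}. f a * ?c)"
      using sub by (intro sum.mono_neutral_cong_right) auto
    thus ?thesis using inj by (simp add: sum.reindex)
  qed
  have "ip ?B \<phi> (app ?B (refl_mat (value_proj g)) \<phi>)
      = (\<Sum>a\<in>?B. app ?B (refl_mat (value_proj g)) \<phi> a * (if a \<in> ?e ` {..<n} then ?c else 0))"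
    unfolding ip_def by (intro sum.cong HOL.refl) (simp add: \<phi>)
  also have "\<dots> = (\<Sum>i<n. app ?B (refl_mat (value_proj g)) \<phi> (?e i) * ?c)"
    by (rule sumB)
  also have "\<dots> = (\<Sum>i<n. of_real (1 / real n) * (of_real (1 - 2 * g i (P i)) :: complex))"
  proof (rule sum.cong[OF HOL.refl])
    fix i assume i: "i \<in> {..<n}"
    have "app ?B (refl_mat (value_proj g)) \<phi> (?e i) = (\<Sum>a\<in>?B. refl_mat (value_proj g) (?e i) a * \<phi> a)"
      using i assms(2) by (simp add: app_def)
    also have "\<dots> = (\<Sum>i'<n. refl_mat (value_proj g) (?e i) (?e i') * ?c)"
      unfolding \<phi> by (rule sumB)
    also have "\<dots> = (\<Sum>i'<n. if i' = i then of_real (1 - 2 * g i (P i)) * ?c else 0)"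
    proof (intro sum.cong HOL.refl)
      fix i'
      have "\<bar>g i (P i)\<bar> = g i (P i)" using g[of i "P i"] by simp
      thus "refl_mat (value_proj g) (?e i) (?e i') * ?c = (if i' = i then of_real (1 - 2 * g i (P i)) * ?c else 0)"
        by (auto simp: refl_mat_def value_proj_def)
    qed
    also have "\<dots> = of_real (1 - 2 * g i (P i)) * ?c" using i by simp
    finally show "app ?B (refl_mat (value_proj g)) \<phi> (?e i) * ?c = of_real (1 / real n) * of_real (1 - 2 * g i (P i))"
      by (simp only: mult.assoc cc) (simp only: mult.commute)
  qed
  also have "\<dots> = of_real (1 / real n * (\<Sum>i<n. 1 - 2 * g i (P i)))"
    by (simp only: of_real_mult of_real_sum sum_distrib_left)
  also have "1 / real n * (\<Sum>i<n. 1 - 2 * g i (P i)) = 1 - 2 * ((1 / real n) * (\<Sum>i<n. g i (P i)))"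
    using assms(1) by (simp add: sum_subtractf sum_distrib_left[symmetric] right_diff_distrib)
  finally show ?thesis .
qed

section \<open>The walk of a forest\<close>

lemma eval_tree_in_leaf_labels: "eval_tree T X \<in> leaf_labels T"
  by (induction T) auto

lemma finite_leaf_labels: "finite (leaf_labels T)"
  by (induction T) auto

lemma eval_tree_bounds:
  assumes "T \<in> set F"
  shows "y_min F \<le> eval_tree T X" "eval_tree T X \<le> y_max F"
proof -
  have "finite (\<Union>T\<in>set F. leaf_labels T)" "eval_tree T X \<in> (\<Union>T\<in>set F. leaf_labels T)"
    using assms finite_leaf_labels eval_tree_in_leaf_labels by auto
  thus "y_min F \<le> eval_tree T X" "eval_tree T X \<le> y_max F"
    by (simp_all add: y_min_def y_max_def)
qed

lemma forest_beta_bounds: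
  assumes "forest_ok F h d"
  shows "0 \<le> forest_beta F X" "forest_beta F X \<le> 1"
proof -
  have n: "real (length F) > 0" and lt: "y_min F < y_max F"
    using assms by (auto simp: forest_ok_def)
  have *: "0 \<le> (eval_tree (F ! i) X - y_min F) / (y_max F - y_min F)"
    "(eval_tree (F ! i) X - y_min F) / (y_max F - y_min F) \<le> 1" if "i < length F" for i
    using eval_tree_bounds[of "F ! i" F X] that lt by auto
  show "0 \<le> forest_beta F X"
    unfolding forest_beta_def using * by (intro mult_nonneg_nonneg sum_nonneg) auto
  have "(\<Sum>i<length F. (eval_tree (F ! i) X - y_min F) / (y_max F - y_min F)) \<le> (\<Sum>i<length F. 1)"
    using * by (intro sum_mono) auto
  thus "forest_beta F X \<le> 1"
    using n by (simp add: forest_beta_def field_simps)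
qed

lemma forest_walk:
  assumes ok: "forest_ok F h d" and d: "0 < d"
  shows "\<exists>(gs :: cell gate list) v w0. w0 \<in> cells (length F) h \<and>
    gates_ok (reg d b (cells (length F) h)) gs \<and> queries gs = 4 * h \<and>
    supported (reg d b (cells (length F) h)) v \<and> ip (reg d b (cells (length F) h)) v v = 1 \<and>
    Im (v (0, 0, w0)) = 0 \<and>
    (\<forall>X k. valid_input d b X \<longrightarrow>
      ip (reg d b (cells (length F) h)) v ((run (reg d b (cells (length F) h)) X gs ^^ k) v) =
        of_real (cos (real k * arccos (2 * forest_beta F X - 1))))"
proof -
  let ?n = "length F"
  let ?B = "reg d b (cells ?n h)"
  have n: "?n > 0" and lt: "y_min F < y_max F"
    and F: "\<And>T. T \<in> set F \<Longrightarrow> attrs_ok d T" "\<And>T. T \<in> set F \<Longrightarrow> height T \<le> h"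
    using ok by (auto simp: forest_ok_def)
  \<comment> \<open>Clamping makes the bounds hold for all arguments, including indices outside the
    forest; on the path of an input it changes nothing.\<close>
  define g where "g = (\<lambda>i p. max 0 (min 1 ((label (descend (F ! i) p h) - y_min F) / (y_max F - y_min F))))"
  have g: "0 \<le> g i p \<and> g i p \<le> 1" for i p by (auto simp: g_def)
  have gpath: "g i (path (F ! i) X h) = (eval_tree (F ! i) X - y_min F) / (y_max F - y_min F)"
    if "i < ?n" for i X
    using that lt eval_tree_bounds[of "F ! i" F X] F(2)[of "F ! i"]
    by (simp add: g_def label_descend_path)
  define v where "v = (\<lambda>a. if a \<in> (\<lambda>i. (0::nat, 0::nat, i, False, {}::nat set)) ` {..<?n}
    then complex_of_real (1 / sqrt (real ?n)) else 0)"
  have sub: "(0, 0, i, False, p) \<in> ?B" if "i < ?n" "p \<subseteq> {..<h}" for i p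
    using that d by (auto simp: reg_def cells_def)
  have sv: "supported ?B v" using sub by (auto simp: supported_def v_def)
  have cc: "complex_of_real (sqrt (real ?n)) * complex_of_real (sqrt (real ?n)) = of_nat ?n"
    unfolding of_real_mult[symmetric] by simp
  have v1: "ip ?B v v = 1"
  proof -
    have "ip ?B v v = (\<Sum>a\<in>(\<lambda>i. (0::nat, 0::nat, i, False, {}::nat set)) ` {..<?n}. of_real (1 / real ?n))"
      unfolding ip_def using sub
      by (intro sum.mono_neutral_cong_right) (auto simp: v_def cc)
    also have "\<dots> = (\<Sum>i<?n. of_real (1 / real ?n))"
      by (subst sum.reindex) (auto simp: inj_on_def)
    finally show ?thesis using n by simp
  qed
  define gs where "gs = eval_gates F h @ Gate (refl_mat (value_proj g)) # rev (eval_gates F h)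
    @ [Gate (refl_mat (proj_mat v))]"
  have P: "\<And>i j. i \<in> ?B \<Longrightarrow> j \<in> ?B \<Longrightarrow> cnj (value_proj g j i) = value_proj g i j"
    "\<And>i j. i \<in> ?B \<Longrightarrow> j \<in> ?B \<Longrightarrow> (\<Sum>k\<in>?B. value_proj g i k * value_proj g k j) = value_proj g i j"
    by (simp_all add: value_proj_hermitian value_proj_idem[OF g])
  have E: "gates_ok ?B (eval_gates F h)" by (rule gates_ok_eval_gates[OF d F(1) order_refl])
  have "ip ?B v ((run ?B X gs ^^ k) v) = of_real (cos (real k * arccos (2 * forest_beta F X - 1)))"
    if X: "valid_input d b X" for X k
  proof (rule run_walk[OF X finite_cells E _ P sv v1 _ gs_def])
    show "app ?B (gate_mat X g) (app ?B (gate_mat X g) \<psi>) = \<psi>"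
      if "g \<in> set (eval_gates F h)" "supported ?B \<psi>" for g \<psi>
      by (rule eval_gates_involution[OF d F(1) X that])
    have p: "path T X h \<subseteq> {..<h}" for T using path_less by blast
    have "ip ?B (run ?B X (eval_gates F h) v) (app ?B (refl_mat (value_proj g)) (run ?B X (eval_gates F h) v))
       = of_real (1 - 2 * ((1 / real ?n) * (\<Sum>i<?n. g i (path (F ! i) X h))))"
      by (rule ip_indicator_value_refl[OF n sub[OF _ p] g])
        (simp_all add: v_def run_eval_gates[OF d F(1) X])
    also have "(1 / real ?n) * (\<Sum>i<?n. g i (path (F ! i) X h)) = forest_beta F X"
      by (simp add: forest_beta_def gpath)
    \<comment> \<open>This is where \<beta> in [0,1] is used: 2 \<beta> - 1 then lies in the domain
      of arccos.\<close>
    also have "1 - 2 * forest_beta F X = - cos (arccos (2 * forest_beta F X - 1))"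
      using forest_beta_bounds[OF ok, of X] by (simp add: cos_arccos)
    finally show "ip ?B (run ?B X (eval_gates F h) v) (app ?B (refl_mat (value_proj g)) (run ?B X (eval_gates F h) v))
       = of_real (- cos (arccos (2 * forest_beta F X - 1)))" .
  qed
  moreover have "gates_ok ?B gs"
    unfolding gs_def using E uni_refl_mat[OF _ P] uni_refl_proj[OF _ v1] by simp
  moreover have "queries gs = 4 * h" by (simp add: gs_def queries_eval_gates)
  moreover have "(0, False, {}) \<in> cells ?n h" using n by (simp add: cells_def)
  ultimately show ?thesis
    using sv v1 by (intro exI[of _ gs] exI[of _ v] exI[of _ "(0, False, {})"]) (auto simp: v_def)
qed

section \<open>Tail bounds and estimation\<close>

definition dirichlet :: "nat \<Rightarrow> real \<Rightarrow> complex" where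
  "dirichlet m \<alpha> = (\<Sum>k<m. cis \<alpha> ^ k)"

text \<open>From (1 - z) D = 1 - z^m with |1 - z| = 2 |sin(\<alpha>/2)| and |1 - z^m| \<le> 2. The
  product form also covers \<alpha> with vanishing sine.\<close>

lemma norm_dirichlet_sin: "cmod (dirichlet m \<alpha>) * \<bar>sin (\<alpha> / 2)\<bar> \<le> 1"
proof -
  have c: "cos \<alpha> = 1 - 2 * (sin (\<alpha> / 2))\<^sup>2"
    using cos_double_sin[of "\<alpha> / 2"] by simp
  have "(cmod (1 - cis \<alpha>))\<^sup>2 = (1 - cos \<alpha>)\<^sup>2 + (sin \<alpha>)\<^sup>2"
    by (simp add: cmod_power2)
  also have "\<dots> = 2 - 2 * cos \<alpha>"
    using sin_cos_squared_add[of \<alpha>] by (simp add: power2_eq_square algebra_simps)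
  also have "\<dots> = (2 * \<bar>sin (\<alpha> / 2)\<bar>)\<^sup>2"
    by (simp add: c power_mult_distrib)
  finally have n: "cmod (1 - cis \<alpha>) = 2 * \<bar>sin (\<alpha> / 2)\<bar>"
    by (subst (asm) power2_eq_iff_nonneg) auto
  have "(1 - cis \<alpha>) * dirichlet m \<alpha> = 1 - cis \<alpha> ^ m"
    by (simp add: dirichlet_def one_diff_power_eq)
  hence "2 * \<bar>sin (\<alpha> / 2)\<bar> * cmod (dirichlet m \<alpha>) = cmod (1 - cis \<alpha> ^ m)"
    by (metis n norm_mult)
  also have "\<dots> \<le> 2"
    using norm_triangle_ineq4[of 1 "cis \<alpha> ^ m"] by (simp add: norm_power)
  finally show ?thesis by (simp add: mult.commute)
qed

lemma sum_norm_fourier: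
  assumes "0 < N"
  shows "(\<Sum>y<N. (cmod (\<Sum>x<N. fourier N y x * c x))\<^sup>2) = (\<Sum>x<N. (cmod (c x))\<^sup>2)"
proof -
  have "complex_of_real (\<Sum>y<N. (cmod (app {..<N} (fourier N) c y))\<^sup>2) = of_real (\<Sum>x<N. (cmod (c x))\<^sup>2)"
    using ip_app[OF _ uni_fourier[OF assms], of c c] by (simp only: ip_self finite_lessThan)
  hence "(\<Sum>y<N. (cmod (app {..<N} (fourier N) c y))\<^sup>2) = (\<Sum>x<N. (cmod (c x))\<^sup>2)"
    by (simp only: of_real_eq_iff)
  thus ?thesis by (simp add: app_def)
qed

lemma sum_spec:
  assumes "0 < N" "(\<Sum>x<N. (cmod (a x))\<^sup>2) = 1"
  shows "(\<Sum>y<N. spec N a \<theta> y) = 1"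
  using sum_norm_fourier[OF assms(1), of "\<lambda>x. a x * cis (real x * \<theta>)"] assms(2)
  by (simp add: spec_def norm_mult mult.assoc)

lemma fourier_cis:
  "fourier N y x * cis (real x * \<theta>) = cis (\<theta> - 2 * pi * real y / real N) ^ x / of_real (sqrt (real N))"
proof -
  have "- (2 * pi * real x * real y / real N) + real x * \<theta> = real x * (\<theta> - 2 * pi * real y / real N)"
    by (simp add: algebra_simps)
  thus ?thesis by (simp add: fourier_def cis_mult Complex.DeMoivre)
qed

text \<open>Parseval for a sequence of m unit-modulus entries padded by zeros to length N; the shift
  \<theta> only changes their phases.\<close>

lemma sum_norm_dirichlet:
  assumes "0 < N" "m \<le> N"
  shows "(\<Sum>y<N. (cmod (dirichlet m (\<theta> - 2 * pi * real y / real N)))\<^sup>2) = real N * real m"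
proof -
  let ?c = "\<lambda>x. if x < m then cis (real x * \<theta>) else 0"
  have "(\<Sum>x<N. fourier N y x * ?c x) = dirichlet m (\<theta> - 2 * pi * real y / real N) / of_real (sqrt (real N))" for y
  proof -
    have "(\<Sum>x<N. fourier N y x * ?c x) = (\<Sum>x<m. fourier N y x * cis (real x * \<theta>))"
      using assms(2) by (intro sum.mono_neutral_cong_right) auto
    thus ?thesis by (simp add: fourier_cis dirichlet_def sum_divide_distrib)
  qed
  hence "(cmod (dirichlet m (\<theta> - 2 * pi * real y / real N)))\<^sup>2 = real N * (cmod (\<Sum>x<N. fourier N y x * ?c x))\<^sup>2" for y
    using assms(1) by (simp add: norm_divide power_divide)
  hence "(\<Sum>y<N. (cmod (dirichlet m (\<theta> - 2 * pi * real y / real N)))\<^sup>2) = real N * (\<Sum>x<N. (cmod (?c x))\<^sup>2)"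
    by (simp only: sum_distrib_left[symmetric] sum_norm_fourier[OF assms(1)])
  also have "(\<Sum>x<N. (cmod (?c x))\<^sup>2) = (\<Sum>x<m. 1)"
    using assms(2) by (intro sum.mono_neutral_cong_right) auto
  finally show ?thesis by simp
qed

text \<open>The window consists of the coefficients of \<open>(1 + z + \<dots> + z\<^bsup>m-1\<^esup>)\<^bsup>K\<^esup>\<close>. Its Fourier
  transform is the \<open>K\<close>-th power of the Dirichlet kernel, whose relative size away from the
  peak is at most \<open>6\<^bsup>-K\<^esup>\<close>.\<close>

lemma ex_window:
  assumes m: "0 < m" and K: "0 < K" and N: "N = K * (m - 1) + 1"
  shows "\<exists>a. (\<Sum>x<N. (cmod (a x))\<^sup>2) = 1 \<and> Im (a 0) = 0 \<and>
    (\<forall>\<theta> Y. Y \<subseteq> {..<N} \<longrightarrow> (\<forall>y\<in>Y. 2 * pi / real m \<le> \<bar>sin ((\<theta> - 2 * pi * real y / real N) / 2)\<bar>) \<longrightarrow>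
      (\<Sum>y\<in>Y. spec N a \<theta> y) \<le> real K / 36 ^ (K - 1))"
proof -
  define q :: "complex poly" where "q = (\<Sum>k<m. monom 1 k)"
  define p where "p = q ^ K"
  have N0: "0 < N" using N by simp
  have "m - 1 \<le> K * (m - 1)" using K by simp
  hence mN: "m \<le> N" using m N by linarith
  have "N \<le> K * (m - 1) + K" using N K by simp
  also have "\<dots> = K * m" using m by (cases m) auto
  finally have NK: "real N \<le> real K * real m" by (metis of_nat_le_iff of_nat_mult)
  have "degree q \<le> m - 1"
    unfolding q_def by (intro degree_sum_le) (auto intro: order.trans[OF degree_monom_le])
  hence "degree p \<le> K * (m - 1)"
    unfolding p_def using degree_power_le[of q K] by (metis le_trans mult.commute mult_le_mono2)
  hence deg: "degree p < N" using N by simp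
  have poly_p: "poly p z = (\<Sum>x<N. coeff p x * z ^ x)" for z
    unfolding poly_altdef using deg
    by (intro sum.mono_neutral_left) (auto simp: coeff_eq_0)
  have poly_q: "poly q z = (\<Sum>k<m. z ^ k)" for z
    by (simp add: q_def poly_sum poly_monom)
  have poly_pq: "poly p z = (\<Sum>k<m. z ^ k) ^ K" for z
    by (simp add: p_def poly_q)
  have "(\<Sum>k<m. (0::complex) ^ k) = 1"
    using m by (simp add: power_0_left sum.delta if_distrib)
  hence c0: "coeff p 0 = 1"
    using poly_pq[of 0] by (simp add: poly_0_coeff_0)
  define s where "s = (\<Sum>x<N. (cmod (coeff p x))\<^sup>2)"
  have "(cmod (coeff p 0))\<^sup>2 \<le> s"
    unfolding s_def using N0 by (intro member_le_sum) auto
  hence s0: "0 < s" using c0 by simp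
  \<comment> \<open>Cauchy-Schwarz at z = 1, where p takes the value m^K: a lower bound on the
    normalising constant s.\<close>
  have ms: "real m ^ (2 * K) \<le> real N * s"
  proof -
    have "real m ^ K = cmod (poly p 1)" by (simp add: poly_pq norm_power)
    also have "\<dots> \<le> (\<Sum>x<N. 1 * cmod (coeff p x))"
      unfolding poly_p by (simp add: sum_norm_le)
    finally have "(real m ^ K)\<^sup>2 \<le> (\<Sum>x<N. 1 * cmod (coeff p x))\<^sup>2"
      by (intro power_mono) auto
    also have "\<dots> \<le> (\<Sum>x<N. 1\<^sup>2) * (\<Sum>x<N. (cmod (coeff p x))\<^sup>2)"
      by (rule Cauchy_Schwarz_ineq_sum)
    finally show ?thesis by (simp add: s_def power_mult[symmetric] mult.commute)
  qed
  define a where "a = (\<lambda>x. coeff p x / of_real (sqrt s))"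
  have a1: "(\<Sum>x<N. (cmod (a x))\<^sup>2) = 1"
    using s0 by (simp add: a_def norm_divide power_divide sum_divide_distrib[symmetric] s_def[symmetric])
  have spec_eq: "spec N a \<theta> y = (cmod (dirichlet m (\<theta> - 2 * pi * real y / real N)))\<^sup>2 ^ K / (real N * s)" for \<theta> y
  proof -
    let ?z = "cis (\<theta> - 2 * pi * real y / real N)"
    have "fourier N y x * a x * cis (real x * \<theta>) =
        coeff p x * ?z ^ x / (of_real (sqrt (real N)) * of_real (sqrt s))" for x
    proof -
      have "fourier N y x * a x * cis (real x * \<theta>) =
          coeff p x * (fourier N y x * cis (real x * \<theta>)) / of_real (sqrt s)"
        by (simp add: a_def)
      thus ?thesis by (simp add: fourier_cis)
    qed
    hence "(\<Sum>x<N. fourier N y x * a x * cis (real x * \<theta>)) =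
        poly p ?z / (of_real (sqrt (real N)) * of_real (sqrt s))"
      by (simp only: poly_p sum_divide_distrib)
    hence "spec N a \<theta> y = (cmod (poly p ?z))\<^sup>2 / (real N * s)"
      using s0 by (simp add: spec_def norm_divide norm_mult power_divide power_mult_distrib)
    thus ?thesis
      by (simp add: poly_pq dirichlet_def norm_power power_mult[symmetric] mult.commute)
  qed
  have "(\<Sum>y\<in>Y. spec N a \<theta> y) \<le> real K / 36 ^ (K - 1)"
    if Y: "Y \<subseteq> {..<N}" and far: "\<And>y. y \<in> Y \<Longrightarrow> 2 * pi / real m \<le> \<bar>sin ((\<theta> - 2 * pi * real y / real N) / 2)\<bar>"
    for \<theta> Y
  proof -
    let ?D = "\<lambda>y. (cmod (dirichlet m (\<theta> - 2 * pi * real y / real N)))\<^sup>2"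
    let ?r = "real m ^ 2 / 36"
    have D: "?D y \<le> ?r" if "y \<in> Y" for y
    proof -
      let ?d = "cmod (dirichlet m (\<theta> - 2 * pi * real y / real N))"
      \<comment> \<open>2 pi > 6 is the origin of the constant 36 = 6^2.\<close>
      have "6 / real m \<le> 2 * pi / real m" using pi_gt3 by (intro divide_right_mono) auto
      hence "?d * (6 / real m) \<le> ?d * \<bar>sin ((\<theta> - 2 * pi * real y / real N) / 2)\<bar>"
        using far[OF that] by (intro mult_left_mono) auto
      also have "\<dots> \<le> 1" by (rule norm_dirichlet_sin)
      finally have "?d \<le> real m / 6" using m by (simp add: field_simps)
      hence "?d\<^sup>2 \<le> (real m / 6)\<^sup>2" by (intro power_mono) auto
      thus ?thesis by (simp add: power_divide)
    qed
    \<comment> \<open>Of the K squared kernel factors, K - 1 are bounded pointwise. The last one is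
      kept and summed over the whole grid by Parseval, which avoids a loss proportional to the size
      of Y.\<close>
    have "(\<Sum>y\<in>Y. spec N a \<theta> y) \<le> (\<Sum>y\<in>Y. ?r ^ (K - 1) * ?D y / (real N * s))"
    proof (rule sum_mono)
      fix y assume y: "y \<in> Y"
      have "?D y ^ K = ?D y ^ (K - 1) * ?D y" using K by (cases K) auto
      also have "\<dots> \<le> ?r ^ (K - 1) * ?D y"
        using D[OF y] by (intro mult_right_mono power_mono) auto
      finally show "spec N a \<theta> y \<le> ?r ^ (K - 1) * ?D y / (real N * s)"
        unfolding spec_eq using s0 by (intro divide_right_mono) auto
    qed
    also have "\<dots> \<le> (\<Sum>y<N. ?r ^ (K - 1) * ?D y / (real N * s))"
      using Y s0 by (intro sum_mono2) auto
    also have "\<dots> = ?r ^ (K - 1) * (\<Sum>y<N. ?D y) / (real N * s)"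
      by (simp only: sum_distrib_left sum_divide_distrib)
    also have "\<dots> = ?r ^ (K - 1) * real m / s"
      using N0 by (simp add: sum_norm_dirichlet[OF N0 mN])
    also have "\<dots> \<le> real K / 36 ^ (K - 1)"
    proof -
      have "real m ^ (2 * (K - 1)) * real m * real m = real m ^ (2 * K)"
        using K by (cases K) (auto simp: power2_eq_square)
      also have "\<dots> \<le> real K * s * real m"
      proof -
        have "real N * s \<le> real K * real m * s" using NK s0 by (intro mult_right_mono) auto
        with ms show ?thesis by (simp only: mult_ac)
      qed
      finally have "real m ^ (2 * (K - 1)) * real m \<le> real K * s"
        using m by simp
      thus ?thesis using s0
        by (simp add: power_divide power_mult[symmetric] divide_le_eq)
    qed
    finally show ?thesis .
  qed
  thus ?thesis using a1 c0 by (intro exI[of _ a]) (auto simp: a_def)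
qed

text \<open>With L = K - 1, split 36^L = 2^L 18^L: the first factor absorbs K = L + 1, the second
  exceeds e^L, hence 1/\<delta>.\<close>

lemma tail_bound:
  assumes "0 < \<delta>" "\<delta> < 1" "K = nat \<lceil>ln (1 / \<delta>)\<rceil> + 1"
  shows "real K / 36 ^ (K - 1) \<le> \<delta>" "real K \<le> 3 * max 1 (ln (1 / \<delta>))"
proof -
  define L where "L = nat \<lceil>ln (1 / \<delta>)\<rceil>"
  have K: "K = L + 1" using assms(3) by (simp add: L_def)
  have ln0: "0 < ln (1 / \<delta>)" using assms by simp
  have L: "ln (1 / \<delta>) \<le> real L" "real L < ln (1 / \<delta>) + 1"
    using ln0 unfolding L_def by linarith+
  show "real K \<le> 3 * max 1 (ln (1 / \<delta>))" using L K by (simp add: max_def)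
  have "Suc L \<le> 2 ^ L" by (simp add: Suc_le_eq)
  hence "real (Suc L) \<le> 2 ^ L" by (metis of_nat_le_iff of_nat_numeral of_nat_power)
  moreover have "1 / \<delta> \<le> 18 ^ L"
  proof -
    have "1 / \<delta> = exp (ln (1 / \<delta>))" using assms by simp
    also have "\<dots> \<le> exp (real L)" using L by simp
    also have "\<dots> = exp 1 ^ L" by (simp add: exp_of_nat_mult[symmetric])
    also have "\<dots> \<le> 18 ^ L" using exp_le by (intro power_mono) auto
    finally show ?thesis .
  qed
  ultimately have "real (Suc L) * (1 / \<delta>) \<le> 2 ^ L * 18 ^ L"
    using assms by (intro mult_mono) auto
  also have "\<dots> = 36 ^ L" by (simp flip: power_mult_distrib)
  finally show "real K / 36 ^ (K - 1) \<le> \<delta>"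
    using assms(1) K by (simp add: field_simps)
qed

text \<open>Half the cosine gap is the product of the two sines, and each is at most 1, so each
  alone exceeds c. A bad outcome is therefore far from both phases \<theta> and -\<theta>.\<close>

lemma sin_bounds_of_cos_diff:
  fixes \<theta> \<psi> c :: real
  assumes "2 * c < \<bar>cos \<psi> - cos \<theta>\<bar>" "0 < c"
  shows "c \<le> \<bar>sin ((\<theta> - \<psi>) / 2)\<bar>" "c \<le> \<bar>sin ((- \<theta> - \<psi>) / 2)\<bar>"
proof -
  have "\<bar>cos \<psi> - cos \<theta>\<bar> = 2 * (\<bar>sin ((\<theta> - \<psi>) / 2)\<bar> * \<bar>sin ((- \<theta> - \<psi>) / 2)\<bar>)"
  proof -
    have "sin ((- \<theta> - \<psi>) / 2) = - sin ((\<psi> + \<theta>) / 2)"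
    proof -
      have "(- \<theta> - \<psi>) / 2 = - ((\<psi> + \<theta>) / 2)"
        by (simp add: add_divide_distrib diff_divide_distrib)
      thus ?thesis by (simp only: sin_minus)
    qed
    thus ?thesis by (simp add: cos_diff_cos abs_mult)
  qed
  hence *: "c < \<bar>sin ((\<theta> - \<psi>) / 2)\<bar> * \<bar>sin ((- \<theta> - \<psi>) / 2)\<bar>" using assms by simp
  moreover have "\<bar>sin ((\<theta> - \<psi>) / 2)\<bar> * \<bar>sin ((- \<theta> - \<psi>) / 2)\<bar> \<le> \<bar>sin ((\<theta> - \<psi>) / 2)\<bar> * 1"
    by (intro mult_left_mono) auto
  moreover have "\<bar>sin ((\<theta> - \<psi>) / 2)\<bar> * \<bar>sin ((- \<theta> - \<psi>) / 2)\<bar> \<le> 1 * \<bar>sin ((- \<theta> - \<psi>) / 2)\<bar>"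
    by (intro mult_right_mono) auto
  ultimately show "c \<le> \<bar>sin ((\<theta> - \<psi>) / 2)\<bar>" "c \<le> \<bar>sin ((- \<theta> - \<psi>) / 2)\<bar>"
    by linarith+
qed

section \<open>The two estimation algorithms\<close>

text \<open>The constant is 12 = 3 * 4: K is at most 3 max(1, ln(1/\<delta>)) and a walk step costs
  4 h queries. The map f is left open so that the same circuit can output a rescaled
  estimate.\<close>

lemma beta_estimation:
  fixes t :: nat
  assumes ok: "forest_ok F h d" and "0 < d" "0 < t" and \<delta>: "0 < \<delta>" "\<delta> < 1"
  shows "\<exists>M U0 Us out. is_query_alg d b M U0 Us \<and>
    real (length Us) \<le> 12 * real t * real h * max 1 (ln (1 / \<delta>)) \<and>
    (\<forall>X f S. valid_input d b X \<longrightarrow>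
       (\<forall>e. \<bar>e - forest_beta F X\<bar> \<le> 2 * pi / real t \<longrightarrow> f e \<in> S) \<longrightarrow>
       1 - \<delta> \<le> out_prob d b M U0 Us (\<lambda>i. f (out i)) X S)"
proof -
  define K where "K = nat \<lceil>ln (1 / \<delta>)\<rceil> + 1"
  define N where "N = K * (t - 1) + 1"
  have N0: "0 < N" and K0: "0 < K" by (simp_all add: N_def K_def)
  note K = tail_bound[OF \<delta> K_def]
  let ?W = "cells (length F) h"
  let ?\<theta> = "\<lambda>X. arccos (2 * forest_beta F X - 1)"
  obtain gs :: "cell gate list" and v w0 where w0: "w0 \<in> ?W"
    and gs: "gates_ok (reg d b ?W) gs" "queries gs = 4 * h"
    and v: "supported (reg d b ?W) v" "ip (reg d b ?W) v v = 1" "Im (v (0, 0, w0)) = 0"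
    and walk: "\<forall>X k. valid_input d b X \<longrightarrow>
      ip (reg d b ?W) v ((run (reg d b ?W) X gs ^^ k) v) = of_real (cos (real k * ?\<theta> X))"
    using forest_walk[OF ok \<open>0 < d\<close>, of b] by blast
  obtain a where window: "(\<Sum>x<N. (cmod (a x))\<^sup>2) = 1 \<and> Im (a 0) = 0 \<and>
    (\<forall>\<theta> Y. Y \<subseteq> {..<N} \<longrightarrow>
      (\<forall>y\<in>Y. 2 * pi / real t \<le> \<bar>sin ((\<theta> - 2 * pi * real y / real N) / 2)\<bar>) \<longrightarrow>
      (\<Sum>y\<in>Y. spec N a \<theta> y) \<le> real K / 36 ^ (K - 1))"
    using ex_window[OF \<open>0 < t\<close> K0 N_def] by (elim exE)
  note a = window[THEN conjunct1] window[THEN conjunct2, THEN conjunct1]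
    and tail = window[THEN conjunct2, THEN conjunct2, rule_format]
  have "even (queries gs)" using gs(2) by simp
  from phase_estimation[OF finite_cells w0 \<open>0 < d\<close> N0 gs(1) this v a walk]
  obtain M U Us out where "is_query_alg d b M U Us \<and> length Us = (N - 1) * queries gs \<and>
    (\<forall>X f S. valid_input d b X \<longrightarrow> out_prob d b M U Us (\<lambda>i. f (out i :: nat)) X S =
       (\<Sum>y\<in>{y. y < N \<and> f y \<in> S}. (spec N a (?\<theta> X) y + spec N a (- ?\<theta> X) y) / 2))"
    by (elim exE)
  hence alg: "is_query_alg d b M U Us" "length Us = (N - 1) * queries gs"
    and prob: "\<And>X f S. valid_input d b X \<Longrightarrow> out_prob d b M U Us (\<lambda>i. f (out i :: nat)) X S =
       (\<Sum>y\<in>{y. y < N \<and> f y \<in> S}. (spec N a (?\<theta> X) y + spec N a (- ?\<theta> X) y) / 2)"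
    by simp_all
  \<comment> \<open>Inverts cos \<theta> = 2 \<beta> - 1; being even in the phase, it is insensitive
    to the sign ambiguity.\<close>
  define est where "est = (\<lambda>y::nat. (1 + cos (2 * pi * real y / real N)) / 2)"
  have "real (length Us) = real K * (real (t - 1) * (4 * real h))"
    by (simp add: alg(2) gs(2) N_def)
  also have "\<dots> \<le> (3 * max 1 (ln (1 / \<delta>))) * (real t * (4 * real h))"
    using K(2) by (intro mult_mono) auto
  finally have len: "real (length Us) \<le> 12 * real t * real h * max 1 (ln (1 / \<delta>))"
    by (simp add: mult_ac)
  have "1 - \<delta> \<le> out_prob d b M U Us (\<lambda>i. f (est (out i))) X S"
    if X: "valid_input d b X"
      and S: "\<And>e. \<bar>e - forest_beta F X\<bar> \<le> 2 * pi / real t \<Longrightarrow> f e \<in> S" for X f S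
  proof -
    let ?P = "\<lambda>y. (spec N a (?\<theta> X) y + spec N a (- ?\<theta> X) y) / 2"
    let ?Y = "{y. y < N \<and> f (est y) \<notin> S}"
    have far: "2 * pi / real t \<le> \<bar>sin ((?\<theta> X - 2 * pi * real y / real N) / 2)\<bar>"
      "2 * pi / real t \<le> \<bar>sin ((- ?\<theta> X - 2 * pi * real y / real N) / 2)\<bar>" if "y \<in> ?Y" for y
    proof -
      have "2 * pi / real t < \<bar>est y - forest_beta F X\<bar>"
        using S[of "est y"] that by force
      also have "est y - forest_beta F X = (cos (2 * pi * real y / real N) - cos (?\<theta> X)) / 2"
        using forest_beta_bounds[OF ok, of X] by (simp add: est_def cos_arccos field_simps)
      finally have "2 * (2 * pi / real t) < \<bar>cos (2 * pi * real y / real N) - cos (?\<theta> X)\<bar>"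
        by simp
      from sin_bounds_of_cos_diff[OF this] \<open>0 < t\<close>
      show "2 * pi / real t \<le> \<bar>sin ((?\<theta> X - 2 * pi * real y / real N) / 2)\<bar>"
        "2 * pi / real t \<le> \<bar>sin ((- ?\<theta> X - 2 * pi * real y / real N) / 2)\<bar>" by simp_all
    qed
    have "(\<Sum>y\<in>?Y. ?P y) = ((\<Sum>y\<in>?Y. spec N a (?\<theta> X) y) + (\<Sum>y\<in>?Y. spec N a (- ?\<theta> X) y)) / 2"
      by (simp only: sum_divide_distrib[symmetric] sum.distrib)
    also have "\<dots> \<le> \<delta>"
    proof -
      have "?Y \<subseteq> {..<N}" by auto
      from tail[OF this far(1)] tail[OF this far(2)] show ?thesis using K(1) by simp
    qed
    finally have bad: "(\<Sum>y\<in>?Y. ?P y) \<le> \<delta>" .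
    have "(\<Sum>y<N. ?P y) = 1"
      by (simp add: sum_divide_distrib[symmetric] sum.distrib sum_spec[OF N0 a(1)])
    moreover have "(\<Sum>y<N. ?P y) = (\<Sum>y\<in>{y. y < N \<and> f (est y) \<in> S}. ?P y) + (\<Sum>y\<in>?Y. ?P y)"
    proof -
      have "{..<N} = {y. y < N \<and> f (est y) \<in> S} \<union> ?Y" by auto
      thus ?thesis by (simp only:) (rule sum.union_disjoint, auto)
    qed
    ultimately have "1 - \<delta> \<le> (\<Sum>y\<in>{y. y < N \<and> f (est y) \<in> S}. ?P y)" using bad by linarith
    thus ?thesis using prob[OF X, of "\<lambda>y. f (est y)" S] by simp
  qed
  thus ?thesis using alg(1) len
    by (intro exI[of _ M] exI[of _ U] exI[of _ Us] exI[of _ "\<lambda>i. est (out i)"]) blast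
qed

lemma forest_pred_eq:
  assumes "forest_ok F h d"
  shows "forest_pred F X = y_min F + (y_max F - y_min F) * forest_beta F X"
proof -
  have n: "real (length F) > 0" and lt: "y_max F - y_min F \<noteq> 0"
    using assms by (auto simp: forest_ok_def)
  have "(y_max F - y_min F) * forest_beta F X =
      (1 / real (length F)) * (\<Sum>i<length F. eval_tree (F ! i) X - y_min F)"
    unfolding forest_beta_def sum_divide_distrib[symmetric] using lt by simp
  also have "\<dots> = forest_pred F X - y_min F"
    using n by (simp add: forest_pred_def sum_subtractf right_diff_distrib)
  finally show ?thesis by simp
qed

lemma constant_alg:
  assumes "0 < d" "c \<in> S"
  shows "is_query_alg d b 1 idm []" "out_prob d b 1 idm [] (\<lambda>_. c) X S = 1"
proof -
  have fB: "finite (qbasis d b 1)" by (simp add: qbasis_def)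
  show "is_query_alg d b 1 idm []"
    using uni_idm[OF fB] by (simp add: is_query_alg_def unitary_on_uni)
  have in_B: "(0, 0, 0) \<in> qbasis d b 1" using assms(1) by (simp add: qbasis_def)
  hence "supported (qbasis d b 1) init_state" by (auto simp: supported_def init_state_def)
  hence "final_state d b 1 idm [] X = init_state"
    using app_idm[OF fB] by (simp add: final_state_def apply_op_app)
  hence "out_prob d b 1 idm [] (\<lambda>_. c) X S = (\<Sum>i\<in>qbasis d b 1. (cmod (init_state i))\<^sup>2)"
    using assms(2) by (simp add: out_prob_def)
  also have "\<dots> = (\<Sum>i\<in>qbasis d b 1. if i = (0, 0, 0) then 1 else 0)"
    by (intro sum.cong) (auto simp: init_state_def)
  also have "\<dots> = 1" using fB in_B by simp
  finally show "out_prob d b 1 idm [] (\<lambda>_. c) X S = 1" .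
qed

lemma pred_estimation:
  fixes t :: nat
  assumes ok: "forest_ok F h d" and "0 < d" "0 < t" and \<delta>: "0 < \<delta>" "\<delta> < 1"
    and T: "T = real_of_int \<lceil>real t * (y_max F - y_min F)\<rceil>"
  shows "\<exists>M U0 Us out. is_query_alg d b M U0 Us \<and>
    real (length Us) \<le> 24 * real t * (y_max F - y_min F) * real h * max 1 (ln (1 / \<delta>)) \<and>
    (\<forall>X. valid_input d b X \<longrightarrow>
       out_prob d b M U0 Us out X
         {e. \<bar>e - forest_pred F X\<bar> \<le> (y_max F - y_min F) * (2 * pi / T + pi\<^sup>2 / T\<^sup>2)} \<ge> 1 - \<delta>)"
proof -
  define \<Delta> where "\<Delta> = y_max F - y_min F"
  have \<Delta>: "0 < \<Delta>" using ok by (simp add: \<Delta>_def forest_ok_def)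
  hence t\<Delta>: "0 < real t * \<Delta>" using \<open>0 < t\<close> by simp
  hence T0: "0 < T" unfolding T \<Delta>_def[symmetric] by simp
  have pred: "forest_pred F X = y_min F + \<Delta> * forest_beta F X" for X
    using forest_pred_eq[OF ok] by (simp add: \<Delta>_def)
  have eps: "2 * pi / T \<le> 2 * pi / T + pi\<^sup>2 / T\<^sup>2" by simp
  show ?thesis
  proof (cases "T \<le> 6")
    case True
    \<comment> \<open>For T \<le> 6 < 2 pi the allowed error is at least the whole label range, so
      the constant answer \<open>y_min F\<close> is good enough.\<close>
    have "6 / T \<le> 2 * pi / T" using T0 pi_gt3 by (intro divide_right_mono) auto
    moreover have "1 \<le> 6 / T" using True T0 by simp
    ultimately have e1: "1 \<le> 2 * pi / T + pi\<^sup>2 / T\<^sup>2" using eps by linarith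
    have "out_prob d b 1 idm [] (\<lambda>_. y_min F) X
        {e. \<bar>e - forest_pred F X\<bar> \<le> \<Delta> * (2 * pi / T + pi\<^sup>2 / T\<^sup>2)} = 1" for X
    proof (rule constant_alg(2)[OF \<open>0 < d\<close>], rule CollectI)
      have "\<bar>y_min F - forest_pred F X\<bar> = \<Delta> * forest_beta F X"
        using \<Delta> forest_beta_bounds[OF ok, of X] by (simp add: pred)
      also have "\<dots> \<le> \<Delta> * (2 * pi / T + pi\<^sup>2 / T\<^sup>2)"
        using \<Delta> forest_beta_bounds[OF ok, of X] e1 by (intro mult_left_mono) auto
      finally show "\<bar>y_min F - forest_pred F X\<bar> \<le> \<Delta> * (2 * pi / T + pi\<^sup>2 / T\<^sup>2)" .
    qed
    moreover have "0 \<le> 24 * real t * \<Delta> * real h * max 1 (ln (1 / \<delta>))"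
      using \<Delta> by simp
    ultimately show ?thesis
      using constant_alg(1)[OF \<open>0 < d\<close>, of 0 UNIV b] \<delta> unfolding \<Delta>_def[symmetric]
      by (intro exI[of _ 1] exI[of _ idm] exI[of _ "[]"] exI[of _ "\<lambda>_. y_min F"]) simp
  next
    case False
    define n where "n = nat \<lceil>real t * \<Delta>\<rceil>"
    have n: "real n = T" using T0 by (simp add: n_def T \<Delta>_def)
    hence n0: "0 < n" using T0 by linarith
    \<comment> \<open>For T > 6 rounding up costs at most a factor 2, which turns the constant 12
      into 24.\<close>
    have "T < real t * \<Delta> + 1" unfolding T \<Delta>_def by linarith
    hence nt: "real n \<le> 2 * (real t * \<Delta>)" using n False by linarith
    from beta_estimation[OF ok \<open>0 < d\<close> n0 \<delta>, of b]
    obtain M U0 Us out where alg: "is_query_alg d b M U0 Us"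
      and len: "real (length Us) \<le> 12 * real n * real h * max 1 (ln (1 / \<delta>))"
      and prob: "\<And>X f S. valid_input d b X \<Longrightarrow>
        (\<And>e. \<bar>e - forest_beta F X\<bar> \<le> 2 * pi / real n \<Longrightarrow> f e \<in> S) \<Longrightarrow>
        1 - \<delta> \<le> out_prob d b M U0 Us (\<lambda>i. f (out i)) X S"
      by blast
    have "12 * real n * real h * max 1 (ln (1 / \<delta>)) \<le> 12 * (2 * (real t * \<Delta>)) * real h * max 1 (ln (1 / \<delta>))"
      using nt by (intro mult_right_mono mult_left_mono) auto
    hence len': "real (length Us) \<le> 24 * real t * \<Delta> * real h * max 1 (ln (1 / \<delta>))"
      using len by (simp add: mult_ac)
    have "1 - \<delta> \<le> out_prob d b M U0 Us (\<lambda>i. y_min F + \<Delta> * out i) X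
        {e. \<bar>e - forest_pred F X\<bar> \<le> \<Delta> * (2 * pi / T + pi\<^sup>2 / T\<^sup>2)}"
      if X: "valid_input d b X" for X
    proof (rule prob[OF X, of "\<lambda>e. y_min F + \<Delta> * e"], rule CollectI)
      fix e assume e: "\<bar>e - forest_beta F X\<bar> \<le> 2 * pi / real n"
      have "\<bar>y_min F + \<Delta> * e - forest_pred F X\<bar> = \<Delta> * \<bar>e - forest_beta F X\<bar>"
        using \<Delta> by (simp add: pred right_diff_distrib[symmetric] abs_mult)
      also have "\<dots> \<le> \<Delta> * (2 * pi / T + pi\<^sup>2 / T\<^sup>2)"
        using order.trans[OF e[unfolded n] eps] \<Delta> by (intro mult_left_mono) auto
      finally show "\<bar>y_min F + \<Delta> * e - forest_pred F X\<bar> \<le> \<Delta> * (2 * pi / T + pi\<^sup>2 / T\<^sup>2)" .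
    qed
    thus ?thesis using alg len' unfolding \<Delta>_def[symmetric] by blast
  qed
qed

theorem theorem1:
  shows "(\<exists>C::real. \<forall>F h d b (t::nat) (\<delta>::real).
            forest_ok F h d \<and> 0 < d \<and> 0 < t \<and> 0 < \<delta> \<and> \<delta> < 1 \<longrightarrow>
            (\<exists>M U0 Us out. is_query_alg d b M U0 Us \<and>
               real (length Us) \<le> C * real t * real h * max 1 (ln (1 / \<delta>)) \<and>
               (\<forall>X. valid_input d b X \<longrightarrow>
                  out_prob d b M U0 Us out X
                    {e. \<bar>e - forest_beta F X\<bar> \<le> 2 * pi / real t + pi\<^sup>2 / (real t)\<^sup>2}
                  \<ge> 1 - \<delta>)))
       \<and> (\<exists>C::real. \<forall>F h d b (t::nat) (\<delta>::real).
            forest_ok F h d \<and> 0 < d \<and> 0 < t \<and> 0 < \<delta> \<and> \<delta> < 1 \<longrightarrow>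
            (let T = real_of_int \<lceil>real t * (y_max F - y_min F)\<rceil> in
             \<exists>M U0 Us out. is_query_alg d b M U0 Us \<and>
               real (length Us) \<le> C * real t * (y_max F - y_min F) * real h * max 1 (ln (1 / \<delta>)) \<and>
               (\<forall>X. valid_input d b X \<longrightarrow>
                  out_prob d b M U0 Us out X
                    {e. \<bar>e - forest_pred F X\<bar> \<le> (y_max F - y_min F) * (2 * pi / T + pi\<^sup>2 / T\<^sup>2)}
                  \<ge> 1 - \<delta>)))"
proof (intro conjI exI[of _ "24 :: real"] allI impI)
  fix F h d b and t :: nat and \<delta> :: real
  assume "forest_ok F h d \<and> 0 < d \<and> 0 < t \<and> 0 < \<delta> \<and> \<delta> < 1"
  then obtain M U0 Us out where alg: "is_query_alg d b M U0 Us"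
      "real (length Us) \<le> 12 * real t * real h * max 1 (ln (1 / \<delta>))"
    and prob: "\<And>X f S. valid_input d b X \<Longrightarrow>
      (\<And>e. \<bar>e - forest_beta F X\<bar> \<le> 2 * pi / real t \<Longrightarrow> f e \<in> S) \<Longrightarrow>
      1 - \<delta> \<le> out_prob d b M U0 Us (\<lambda>i. f (out i)) X S"
    using beta_estimation[of F h d t \<delta> b] by blast
  have "12 * real t * real h * max 1 (ln (1 / \<delta>)) \<le> 24 * real t * real h * max 1 (ln (1 / \<delta>))"
    by (intro mult_right_mono) auto
  hence "real (length Us) \<le> 24 * real t * real h * max 1 (ln (1 / \<delta>))"
    using alg(2) by linarith
  moreover have "1 - \<delta> \<le> out_prob d b M U0 Us out X
      {e. \<bar>e - forest_beta F X\<bar> \<le> 2 * pi / real t + pi\<^sup>2 / (real t)\<^sup>2}"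
    if X: "valid_input d b X" for X
  proof (rule prob[OF X, of "\<lambda>e. e"], rule CollectI)
    fix e assume "\<bar>e - forest_beta F X\<bar> \<le> 2 * pi / real t"
    thus "\<bar>e - forest_beta F X\<bar> \<le> 2 * pi / real t + pi\<^sup>2 / (real t)\<^sup>2"
      by (rule order.trans) simp
  qed
  ultimately show "\<exists>M U0 Us out. is_query_alg d b M U0 Us \<and>
       real (length Us) \<le> 24 * real t * real h * max 1 (ln (1 / \<delta>)) \<and>
       (\<forall>X. valid_input d b X \<longrightarrow>
          out_prob d b M U0 Us out X
            {e. \<bar>e - forest_beta F X\<bar> \<le> 2 * pi / real t + pi\<^sup>2 / (real t)\<^sup>2}
          \<ge> 1 - \<delta>)"
    using alg(1) by blast
next
  fix F h d b and t :: nat and \<delta> :: real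
  assume "forest_ok F h d \<and> 0 < d \<and> 0 < t \<and> 0 < \<delta> \<and> \<delta> < 1"
  thus "let T = real_of_int \<lceil>real t * (y_max F - y_min F)\<rceil> in
       \<exists>M U0 Us out. is_query_alg d b M U0 Us \<and>
         real (length Us) \<le> 24 * real t * (y_max F - y_min F) * real h * max 1 (ln (1 / \<delta>)) \<and>
         (\<forall>X. valid_input d b X \<longrightarrow>
            out_prob d b M U0 Us out X
              {e. \<bar>e - forest_pred F X\<bar> \<le> (y_max F - y_min F) * (2 * pi / T + pi\<^sup>2 / T\<^sup>2)}
            \<ge> 1 - \<delta>)"
    unfolding Let_def using pred_estimation[OF _ _ _ _ _ HOL.refl, of F h d t \<delta> b] by blast
qed

end
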